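(* Let $q$ be a real number with $1<q<2$ which is not a Pisot number. Then: (i) if $1<q\le \sqrt[3]{2}$, then $L^1(q)=0$; (ii) if $1<q\le \sqrt{2}$, then $\ell^1(q)=0$ and $L^2(q)=0$; (iii) if $1<q<2$, then $\ell^2(q)=0$ and $L^3(q)=0$.
   Context: For a real number $q>1$ and a positive integer $m$, let $X^m(q)=\left\{\sum_{i=0}^n s_iq^i : n\in\{0,1,2,\ldots\},\ s_i\in\{0,1,\ldots,m\}\right\}$. This is an unbounded set of nonnegative reals having only finitely many elements in each bounded interval, so its elements can be arranged into a strictly increasing sequence $0=x_0^m(q)<x_1^m(q)<x_2^m(q)<\cdots$. Define $\ell^m(q)=\liminf_{k\to\infty}(x_{k+1}^m(q)-x_k^m(q))$ and $L^m(q)=\limsup_{k\to\infty}(x_{k+1}^m(q)-x_k^m(q))$. A Pisot number is a real algebraic integer $>1$ all of whose other algebraic conjugates have modulus strictly less than one. *)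

theory Defs
  imports "HOL-Analysis.Analysis" "HOL-Computational_Algebra.Polynomial"
begin

definition is_min_rat_poly :: "rat poly \<Rightarrow> complex \<Rightarrow> bool" where
  "is_min_rat_poly p z \<longleftrightarrow>
     lead_coeff p = 1 \<and> irreducible p \<and> poly (map_poly of_rat p) z = 0"

(* Includes z itself when z is algebraic; empty when z is transcendental. *)
definition algebraic_conjugates :: "complex \<Rightarrow> complex set" where
  "algebraic_conjugates z =
     {w. \<exists>p. is_min_rat_poly p z \<and> poly (map_poly of_rat p) w = 0}"

definition Pisot :: "real \<Rightarrow> bool" where
  "Pisot q \<longleftrightarrow> algebraic_int q \<and> q > 1 \<and>
     (\<forall>w \<in> algebraic_conjugates (of_real q) - {of_real q}. norm w < 1)"

definition spectrum :: "nat \<Rightarrow> real \<Rightarrow> real set" where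
  "spectrum m q = {(\<Sum>i\<le>n. real (s i) * q ^ i) | n s. \<forall>i\<le>n. s i \<in> {0..m}}"

(* Well-defined for q > 1 and m > 0, see spectrum_seq below.  The library's enumerate
   needs a well-ordered type, hence it is not applicable to sets of reals. *)
definition spectrum_seq :: "nat \<Rightarrow> real \<Rightarrow> nat \<Rightarrow> real" where
  "spectrum_seq m q = (THE x. strict_mono x \<and> range x = spectrum m q)"

definition lower_gap :: "nat \<Rightarrow> real \<Rightarrow> ereal" where
  "lower_gap m q = liminf (\<lambda>k. ereal (spectrum_seq m q (Suc k) - spectrum_seq m q k))"

definition upper_gap :: "nat \<Rightarrow> real \<Rightarrow> ereal" where
  "upper_gap m q = limsup (\<lambda>k. ereal (spectrum_seq m q (Suc k) - spectrum_seq m q k))"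

lemma strict_mono_range_unique:
  fixes f g :: "nat \<Rightarrow> real"
  assumes f: "strict_mono f" and g: "strict_mono g" and r: "range f = range g"
  shows "f = g"
proof -
  have le: "u n \<le> v n"
    if u: "strict_mono u" and v: "strict_mono v" and uv: "range v \<subseteq> range u"
    for u v :: "nat \<Rightarrow> real" and n
  proof -
    have "\<forall>k. \<exists>j. v k = u j" using uv by blast
    then obtain h where h: "\<And>k. v k = u (h k)" by metis
    have "strict_mono h"
    proof (rule strict_monoI)
      fix a b :: nat assume "a < b"
      then have "u (h a) < u (h b)" using v h by (metis strict_monoD)
      then show "h a < h b" using u by (simp add: strict_mono_less)
    qed
    then have "n \<le> h n" by (rule strict_mono_imp_increasing)
    then show ?thesis using u h by (simp add: strict_mono_less_eq)
  qed
  show ?thesis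
    using le[OF f g] le[OF g f] r by (intro ext antisym) auto
qed

lemma strict_mono_range_exists:
  fixes S :: "real set"
  assumes inf: "infinite S" and fin: "\<And>b. finite {y \<in> S. y \<le> b}"
  shows "\<exists>f::nat \<Rightarrow> real. strict_mono f \<and> range f = S"
proof -
  have least: "\<exists>y\<in>T. \<forall>z\<in>T. y \<le> z" if T: "T \<subseteq> S" "T \<noteq> {}" for T
  proof -
    obtain t where t: "t \<in> T" using T by blast
    have F: "finite {y \<in> T. y \<le> t}"
      by (rule finite_subset[OF _ fin[of t]]) (use T in auto)
    have m: "Min {y \<in> T. y \<le> t} \<in> {y \<in> T. y \<le> t}"
      by (rule Min_in[OF F]) (use t in auto)
    have "Min {y \<in> T. y \<le> t} \<le> z" if "z \<in> T" for z
    proof (cases "z \<le> t")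
      case True
      then show ?thesis using F that by (intro Min_le) auto
    next
      case False
      then show ?thesis using m by auto
    qed
    then show ?thesis using m by blast
  qed
  have above: "{y \<in> S. a < y} \<noteq> {}" for a
  proof
    assume "{y \<in> S. a < y} = {}"
    then have "S = {y \<in> S. y \<le> a}" by force
    then show False using inf fin[of a] by metis
  qed
  have "\<exists>y. y \<in> S \<and> a < y \<and> (\<forall>z\<in>S. a < z \<longrightarrow> y \<le> z)" for a
    using least[of "{y \<in> S. a < y}"] above[of a] by auto
  then obtain nx where nx: "\<And>a. nx a \<in> S" "\<And>a. a < nx a"
      "\<And>a z. z \<in> S \<Longrightarrow> a < z \<Longrightarrow> nx a \<le> z"
    by metis
  obtain s0 where s0: "s0 \<in> S" "\<And>z. z \<in> S \<Longrightarrow> s0 \<le> z"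
    using least[of S] inf by (metis finite.emptyI order_refl)
  define f where "f = rec_nat s0 (\<lambda>_ a. nx a)"
  have f0: "f 0 = s0" and fS: "\<And>n. f (Suc n) = nx (f n)" by (simp_all add: f_def)
  have sm: "strict_mono f" by (simp add: strict_mono_Suc_iff fS nx)
  have sub: "range f \<subseteq> S"
  proof
    fix y assume "y \<in> range f"
    then obtain n where "y = f n" by blast
    then show "y \<in> S" by (cases n) (simp_all add: f0 s0 fS nx)
  qed
  have "s \<in> range f" if s: "s \<in> S" for s
  proof (rule ccontr)
    assume n: "s \<notin> range f"
    have "f k < s" for k
    proof (induction k)
      case 0
      have "s \<noteq> f 0" using n by blast
      then show ?case using s0(2)[OF s] f0 by simp
    next
      case (Suc k)
      have "s \<noteq> f (Suc k)" using n by blast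
      then show ?case using nx(3)[OF s Suc] fS by simp
    qed
    then have "range f \<subseteq> {y \<in> S. y \<le> s}" using sub by (auto intro: less_imp_le)
    then have "finite (range f)" using fin finite_subset by blast
    then show False using sm by (simp add: finite_image_iff strict_mono_imp_inj_on)
  qed
  then show ?thesis using sm sub by (intro exI[of _ f]) auto
qed

lemma finite_spectrum_atMost:
  assumes q: "q > 1"
  shows "finite {y \<in> spectrum m q. y \<le> b}"
proof -
  obtain N where N: "b < q ^ N" using real_arch_pow[OF q] by blast
  let ?g = "\<lambda>s. \<Sum>i<N. real (s i) * q ^ i"
  have "{y \<in> spectrum m q. y \<le> b} \<subseteq> ?g ` ({..<N} \<rightarrow>\<^sub>E {0..m})"
  proof
    fix y assume y: "y \<in> {y \<in> spectrum m q. y \<le> b}"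
    then obtain n s where s: "\<forall>i\<le>n. s i \<in> {0..m}" and
        y_eq: "y = (\<Sum>i\<le>n. real (s i) * q ^ i)"
      unfolding spectrum_def by blast
    have z: "s i = 0" if i: "i \<le> n" "N \<le> i" for i
    proof (rule ccontr)
      assume "s i \<noteq> 0"
      then have "1 \<le> real (s i)" by simp
      then have "q ^ i \<le> real (s i) * q ^ i" using q by simp
      moreover have "q ^ N \<le> q ^ i" using q i by (intro power_increasing) auto
      moreover have "real (s i) * q ^ i \<le> y"
        unfolding y_eq using q i by (intro member_le_sum) auto
      ultimately show False using N y by auto
    qed
    define t where "t = restrict (\<lambda>i. if i \<le> n then s i else 0) {..<N}"
    have "t \<in> {..<N} \<rightarrow>\<^sub>E {0..m}" using s by (auto simp: t_def)
    moreover have "y = ?g t"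
    proof -
      have "?g t = (\<Sum>i\<in>{..<N}. if i \<in> {..n} then real (s i) * q ^ i else 0)"
        by (intro sum.cong) (auto simp: t_def)
      also have "\<dots> = (\<Sum>i\<in>{..<N} \<inter> {..n}. real (s i) * q ^ i)"
        by (simp add: sum.inter_restrict)
      also have "\<dots> = y"
        unfolding y_eq by (rule sum.mono_neutral_left) (auto simp: z)
      finally show ?thesis ..
    qed
    ultimately show "y \<in> ?g ` ({..<N} \<rightarrow>\<^sub>E {0..m})" by blast
  qed
  then show ?thesis by (rule finite_subset) (intro finite_imageI finite_PiE, auto)
qed

lemma infinite_spectrum:
  assumes q: "q > 1" and m: "m > 0"
  shows "infinite (spectrum m q)"
proof -
  have "q ^ n \<in> spectrum m q" for n
  proof -
    let ?s = "\<lambda>i. if i = n then 1 else 0 :: nat"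
    have "q ^ n = (\<Sum>i\<le>n. if i = n then q ^ i else 0)" by simp
    also have "\<dots> = (\<Sum>i\<le>n. real (?s i) * q ^ i)" by (intro sum.cong) auto
    finally show ?thesis
      unfolding spectrum_def mem_Collect_eq using m
      by (intro exI[of _ n] exI[of _ ?s]) auto
  qed
  then have "range (\<lambda>n. q ^ n) \<subseteq> spectrum m q" by blast
  moreover have "inj (\<lambda>n. q ^ n)" using q by (intro injI) (simp add: power_inject_exp)
  then have "infinite (range (\<lambda>n. q ^ n))" by (simp add: finite_image_iff)
  ultimately show ?thesis using finite_subset by blast
qed

lemma spectrum_seq:
  assumes "q > 1" and "m > 0"
  shows "strict_mono (spectrum_seq m q)" and "range (spectrum_seq m q) = spectrum m q"
proof -
  have "\<exists>!x::nat \<Rightarrow> real. strict_mono x \<and> range x = spectrum m q"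
    by (intro ex_ex1I strict_mono_range_exists infinite_spectrum finite_spectrum_atMost assms)
      (rule strict_mono_range_unique, auto)
  from theI'[OF this] show "strict_mono (spectrum_seq m q)"
    and "range (spectrum_seq m q) = spectrum m q"
    by (simp_all add: spectrum_seq_def)
qed

end

theory Submission
  imports Defs
begin

text \<open>
  Everything follows from: if \<open>1 < q < 2\<close> and \<open>0\<close> is not an accumulation point of the set \<open>Y\<close> of
  values at \<open>q\<close> of polynomials with coefficients \<open>-1, 0, 1\<close>, then \<open>q\<close> is a Pisot number.

  First, \<open>Y\<close> is then locally finite (Feng). Let a window of length \<open>1 / (q - 1)\<close> contain the maximal
  number of values of \<open>0\<close>-\<open>1\<close> words of a fixed length. By maximality, prefixing the words with any \<open>v\<close>
  translates the content of the window without adding to it; since a nearby \<open>v'\<close> can be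
  continued into the window of \<open>v\<close>, the difference \<open>v - v'\<close> takes only finitely many values.

  Secondly, let \<open>w\<close> be a conjugate of \<open>q\<close> with modulus at least one. If a series \<open>\<Sum> d\<^sub>i q\<^sup>-\<^sup>i\<close> with
  \<open>d\<^sub>i \<in> {-1, 0, 1}\<close> represents \<open>y \<in> Y\<close>, its tails take finitely many values, so the corresponding
  tails at \<open>w\<close> are bounded and the series at \<open>w\<close> represents the conjugate of \<open>y\<close>. A small \<open>y\<close> has an
  expansion whose digits \<open>d\<^sub>i\<close> all have the sign of \<open>Re (\<gamma> w\<^sup>-\<^sup>i)\<close>, and another one whose digits all
  have the opposite sign, so the conjugate \<open>y'\<close> satisfies both \<open>Re (\<gamma> y') \<ge> 0\<close> and \<open>Re (\<gamma> y') \<le> 0\<close>,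
  which forces \<open>y = 0\<close>. A suitable nonzero \<open>y\<close> exists unless \<open>q\<close> is a multinacci number, where the
  conjugates are estimated directly.

  For the upper gaps, tiny differences are scaled on disjoint blocks of digits to a chain of steps below
  \<open>\<epsilon>\<close> that bridges the gaps of a second, relatively dense, set of values. If only the digits \<open>0, 1\<close> are
  available, the two sets use disjoint classes of exponents modulo \<open>k \<in> {2, 3}\<close>, where \<open>k\<close> is chosen
  such that \<open>q\<^sup>k\<close> is not a Pisot number.
\<close>

section \<open>Conjugates\<close>

text \<open>Polymorphic in the field, so that one rational polynomial can be evaluated at the real
  base and at a complex conjugate.\<close>

definition rpoly :: "rat poly \<Rightarrow> 'a::field_char_0 \<Rightarrow> 'a" where
  "rpoly P z = poly (map_poly of_rat P) z"

lemma rpoly_0 [simp]: "rpoly 0 z = 0"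
  by (simp add: rpoly_def)

lemma rpoly_pCons [simp]: "rpoly (pCons a P) z = of_rat a + z * rpoly P z"
  by (simp add: rpoly_def map_poly_pCons)

lemma rpoly_1 [simp]: "rpoly 1 z = 1"
  by (simp add: one_pCons)

lemma rpoly_add [simp]: "rpoly (P + Q) z = rpoly P z + rpoly Q z"
  by (induction P Q rule: poly_induct2) (simp_all add: of_rat_add algebra_simps)

lemma rpoly_smult [simp]: "rpoly (smult a P) z = of_rat a * rpoly P z"
  by (induction P) (simp_all add: of_rat_mult algebra_simps)

lemma rpoly_mult [simp]: "rpoly (P * Q) z = rpoly P z * rpoly Q z"
  by (induction P) (simp_all add: algebra_simps)

lemma rpoly_minus [simp]: "rpoly (- P) z = - rpoly P z"
  using rpoly_smult[of "-1" P z] by simp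

lemma rpoly_diff [simp]: "rpoly (P - Q) z = rpoly P z - rpoly Q z"
  using rpoly_add[of P "- Q" z] by simp

lemma rpoly_power [simp]: "rpoly (P ^ n) z = rpoly P z ^ n"
  by (induction n) simp_all

lemma rpoly_pcompose: "rpoly (pcompose P Q) z = rpoly P (rpoly Q z)"
  by (induction P) (simp_all add: pcompose_pCons)

lemma rpoly_of_real: "rpoly P (of_real x :: complex) = of_real (rpoly P x)"
proof (induction P)
  case (pCons a P)
  have "(of_rat a :: complex) = of_real (of_rat a)"
    by (cases a rule: Rat_cases) (simp add: of_rat_rat)
  with pCons show ?case by simp
qed simp

text \<open>For algebraic \<open>x\<close> this is conjugacy, see
  \<open>algebraic_conjugates_conj_pair\<close>; in this form every rational polynomial identity
  passes between \<open>x\<close> and \<open>w\<close> without a minimal polynomial.\<close>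

definition conj_pair :: "real \<Rightarrow> complex \<Rightarrow> bool" where
  "conj_pair x w \<longleftrightarrow> (\<forall>P. rpoly P x = 0 \<longleftrightarrow> rpoly P w = 0)"

lemma conj_pair_eq_iff:
  assumes "conj_pair x w"
  shows "rpoly P x = rpoly Q x \<longleftrightarrow> rpoly P w = rpoly Q w"
  using assms[unfolded conj_pair_def, rule_format, of "P - Q"] by simp

lemma conj_pair_power:
  assumes "conj_pair x w"
  shows "conj_pair (x ^ k) (w ^ k)"
  unfolding conj_pair_def
proof
  fix P :: "rat poly"
  have *: "rpoly P (z ^ k) = rpoly (pcompose P ([:0, 1:] ^ k)) z" for z :: "'a::field_char_0"
    by (simp add: rpoly_pcompose)
  show "rpoly P (x ^ k) = 0 \<longleftrightarrow> rpoly P (w ^ k) = 0"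
    using assms unfolding * conj_pair_def by blast
qed

lemma min_degree_rat_poly:
  fixes z :: "'a::field_char_0"
  assumes "algebraic z"
  obtains g where "g \<noteq> 0" "rpoly g z = 0" "\<And>P. rpoly P z = 0 \<longleftrightarrow> g dvd P"
proof -
  obtain p :: "int poly" where p: "poly (map_poly of_int p) z = 0" "p \<noteq> 0"
    using assms by (elim algebraicE')
  have "rpoly (map_poly of_int p) z = 0"
    using p(1) by (simp add: rpoly_def map_poly_map_poly o_def)
  moreover have "map_poly of_int p \<noteq> (0 :: rat poly)"
    using p(2) by (simp add: map_poly_eq_0_iff)
  ultimately have "\<exists>g. g \<noteq> 0 \<and> rpoly g z = 0" by blast
  then obtain g where g: "g \<noteq> 0 \<and> rpoly g z = 0"
      and min: "\<And>h. h \<noteq> 0 \<and> rpoly h z = 0 \<Longrightarrow> degree g \<le> degree h"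
    using ex_has_least_nat[of "\<lambda>g. g \<noteq> 0 \<and> rpoly g z = 0" _ degree] by blast
  have "g dvd P" if "rpoly P z = 0" for P
  proof -
    have "rpoly (P mod g) z = 0"
      using that g rpoly_mult[of "P div g" g z] rpoly_add[of "P div g * g" "P mod g" z] by simp
    then have "P mod g = 0"
      using degree_mod_less[of g P] g min[of "P mod g"] by force
    then show ?thesis by (simp add: mod_eq_0_iff_dvd)
  qed
  moreover have "rpoly P z = 0" if "g dvd P" for P
    using that g by (elim dvdE) simp
  ultimately show thesis using that g by blast
qed

lemma exists_min_rat_poly:
  assumes "algebraic z"
  shows "\<exists>p. is_min_rat_poly p z"
proof -
  obtain g where g: "g \<noteq> 0" "rpoly g z = 0" and dvd: "\<And>P. rpoly P z = 0 \<longleftrightarrow> g dvd P"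
    using min_degree_rat_poly[OF assms] by blast
  define p where "p = smult (inverse (lead_coeff g)) g"
  have p: "p \<noteq> 0" "rpoly p z = 0" "lead_coeff p = 1"
    using g by (simp_all add: p_def)
  have dvd': "rpoly P z = 0 \<longleftrightarrow> p dvd P" for P
    using g(1) dvd by (simp add: p_def smult_dvd_iff)
  have "irreducible p"
  proof (rule irreducibleI)
    show "\<not> p dvd 1" using dvd'[of 1] by simp
  next
    fix a b assume ab: "p = a * b"
    then have "p dvd a \<or> p dvd b"
      using p(2) dvd'[of a] dvd'[of b] by simp
    then show "a dvd 1 \<or> b dvd 1"
      using p(1) ab by (metis dvd_mult_cancel_left dvd_mult_cancel_right mult.right_neutral
          mult_cancel_left2 mult_eq_0_iff mult.left_neutral)
  qed (use p in auto)
  then show ?thesis using p by (auto simp: is_min_rat_poly_def rpoly_def)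
qed

text \<open>A generator of the ideal of polynomials vanishing at \<open>z\<close> is a non-unit
  dividing the irreducible \<open>p\<close>, hence an associate of \<open>p\<close>.\<close>

lemma min_rat_poly_dvd_iff:
  assumes "is_min_rat_poly p z"
  shows "rpoly P z = 0 \<longleftrightarrow> p dvd P"
proof -
  have p: "lead_coeff p = 1" "irreducible p" "rpoly p z = 0"
    using assms by (auto simp: is_min_rat_poly_def rpoly_def)
  have "algebraic z"
    unfolding algebraic_altdef
    by (rule exI[of _ "map_poly of_rat p"])
      (use p in \<open>auto simp: rpoly_def coeff_map_poly map_poly_eq_0_iff\<close>)
  then obtain g where g: "g \<noteq> 0" "rpoly g z = 0" and dvd: "\<And>P. rpoly P z = 0 \<longleftrightarrow> g dvd P"
    using min_degree_rat_poly by blast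
  have "g dvd p" using dvd p by blast
  then obtain h where h: "p = g * h" by (elim dvdE)
  have "\<not> g dvd 1" using dvd[of 1] by simp
  then have "h dvd 1" using irreducibleD[OF p(2) h] by blast
  then have "p dvd g" using h by (metis dvd_mult_unit_iff' dvd_refl mult.commute)
  then show ?thesis using dvd \<open>g dvd p\<close> dvd_trans by blast
qed

lemma algebraic_conjugates_conj_pair:
  assumes "algebraic x"
  shows "w \<in> algebraic_conjugates (of_real x) \<longleftrightarrow> conj_pair x w"
proof
  have r: "rpoly P x = 0 \<longleftrightarrow> rpoly P (of_real x :: complex) = 0" for P
    by (simp add: rpoly_of_real)
  {
    assume "w \<in> algebraic_conjugates (of_real x)"
    then obtain p where p: "is_min_rat_poly p (of_real x)" "rpoly p w = 0"
      by (auto simp: algebraic_conjugates_def rpoly_def)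
    then have "is_min_rat_poly p w" by (simp add: is_min_rat_poly_def rpoly_def)
    with p(1) show "conj_pair x w" by (simp add: conj_pair_def r min_rat_poly_dvd_iff)
  next
    assume w: "conj_pair x w"
    obtain p where p: "is_min_rat_poly p (of_real x)"
      using exists_min_rat_poly assms algebraic_of_real by blast
    then have "rpoly p w = 0"
      using w r by (simp add: conj_pair_def is_min_rat_poly_def rpoly_def)
    with p show "w \<in> algebraic_conjugates (of_real x)"
      by (auto simp: algebraic_conjugates_def rpoly_def)
  }
qed

lemma Pisot_iff:
  "Pisot x \<longleftrightarrow> algebraic_int x \<and> x > 1 \<and> (\<forall>w. conj_pair x w \<longrightarrow> w \<noteq> of_real x \<longrightarrow> norm w < 1)"
  using algebraic_conjugates_conj_pair[of x] by (auto simp: Pisot_def)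

text \<open>If a conjugate \<open>w\<close> has modulus at least one, so have \<open>w ^ 2\<close>
  and \<open>w ^ 3\<close>, which must then be \<open>x ^ 2\<close> and \<open>x ^ 3\<close>;
  dividing gives \<open>w = x\<close>.\<close>

lemma Pisot_of_powers:
  assumes x: "x > 1" and 2: "Pisot (x ^ 2)" and 3: "Pisot (x ^ 3)"
  shows "Pisot x"
  unfolding Pisot_iff
proof (intro conjI allI impI)
  have "algebraic_int (sqrt (x ^ 2))" using 2 by (intro algebraic_int_sqrt) (simp add: Pisot_iff)
  then show "algebraic_int x" using x by simp
  fix w assume w: "conj_pair x w" "w \<noteq> of_real x"
  show "norm w < 1"
  proof (rule ccontr)
    assume "\<not> norm w < 1"
    then have ge: "norm (w ^ k) \<ge> 1" for k by (simp add: norm_power)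
    have "w ^ 2 = of_real (x ^ 2)" "w ^ 3 = of_real (x ^ 3)"
      using 2 3 conj_pair_power[OF w(1)] ge by (meson Pisot_iff leD)+
    then have "w * of_real (x ^ 2) = of_real x * of_real (x ^ 2)"
      by (simp add: power2_eq_square power3_eq_cube)
    then show False using w x by simp
  qed
qed (use x in auto)

text \<open>Excludes the endpoint \<open>q ^ k = 2\<close> when a power of the base is chosen at the
  end.\<close>

lemma Pisot_2: "Pisot 2"
proof -
  have "w = 2" if "conj_pair 2 w" for w
    using that[unfolded conj_pair_def, rule_format, of "[:-2, 1:]"] by (simp add: algebra_simps)
  moreover have "algebraic_int (2 :: real)" by (intro int_imp_algebraic_int) auto
  ultimately show ?thesis by (auto simp: Pisot_iff)
qed

section \<open>Values of words with digits 0 and 1\<close>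

text \<open>The digit with index 0 is the most significant, so lengthening a word is one affine
  step. The target is any commutative ring because words are also evaluated at the polynomial
  \<open>[:0, 1:]\<close>.\<close>

primrec horner :: "(nat \<Rightarrow> int) \<Rightarrow> 'a::comm_ring_1 \<Rightarrow> nat \<Rightarrow> 'a" where
  "horner d z 0 = 0"
| "horner d z (Suc n) = z * horner d z n + of_int (d n)"

lemma horner_diff: "horner (\<lambda>i. d i - e i) z n = horner d z n - horner e z n"
  by (induction n) (simp_all add: right_diff_distrib)

lemma horner_cong: "(\<And>i. i < n \<Longrightarrow> d i = e i) \<Longrightarrow> horner d z n = horner e z n"
  by (induction n) simp_all

definition digit_sums :: "real \<Rightarrow> nat \<Rightarrow> real set" where
  "digit_sums q n = {horner s q n | s. \<forall>i. s i \<in> {0, 1}}"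

text \<open>Equivalently the values at \<open>q\<close> of polynomials with coefficients -1, 0, 1,
  since a word with such digits splits into its positive and negative parts.\<close>

definition digit_diffs :: "real \<Rightarrow> real set" where
  "digit_diffs q = {x - x' | n x x'. x \<in> digit_sums q n \<and> x' \<in> digit_sums q n}"

lemma digit_sums_0 [simp]: "digit_sums q 0 = {0}"
  by (auto simp: digit_sums_def intro: exI[of _ "\<lambda>_. 0"])

lemma digit_sums_Suc:
  "x \<in> digit_sums q (Suc n) \<longleftrightarrow> (\<exists>y \<in> digit_sums q n. x = q * y \<or> x = q * y + 1)"
proof
  assume "x \<in> digit_sums q (Suc n)"
  then obtain s where s: "\<forall>i. s i \<in> {0, 1}" "x = horner s q (Suc n)"
    by (auto simp: digit_sums_def)
  then have "horner s q n \<in> digit_sums q n" by (auto simp: digit_sums_def)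
  then show "\<exists>y \<in> digit_sums q n. x = q * y \<or> x = q * y + 1"
    using s(1)[rule_format, of n] s(2) by (intro bexI[of _ "horner s q n"]) auto
next
  assume "\<exists>y \<in> digit_sums q n. x = q * y \<or> x = q * y + 1"
  then obtain s where s: "\<forall>i. s i \<in> {0, 1}" and "x = q * horner s q n \<or> x = q * horner s q n + 1"
    by (auto simp: digit_sums_def)
  then obtain d :: int where d: "d \<in> {0, 1}" and x: "x = q * horner s q n + of_int d"
    by (metis add.right_neutral insertI1 insertI2 of_int_0 of_int_1)
  have "horner (s(n := d)) q n = horner s q n" by (rule horner_cong) simp
  then have "x = horner (s(n := d)) q (Suc n)" using x by simp
  moreover have "\<forall>i. (s(n := d)) i \<in> {0, 1}" using s d by simp
  ultimately show "x \<in> digit_sums q (Suc n)" unfolding digit_sums_def by blast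
qed

lemma digit_sums_append:
  "x \<in> digit_sums q k \<Longrightarrow> w \<in> digit_sums q n \<Longrightarrow> q ^ n * x + w \<in> digit_sums q (k + n)"
proof (induction n arbitrary: w)
  case (Suc n)
  then obtain y where y: "y \<in> digit_sums q n" "w = q * y \<or> w = q * y + 1"
    by (auto simp: digit_sums_Suc)
  have "q ^ n * x + y \<in> digit_sums q (k + n)" using Suc y by blast
  moreover have "q ^ Suc n * x + w = q * (q ^ n * x + y) \<or> q ^ Suc n * x + w = q * (q ^ n * x + y) + 1"
    using y(2) by (auto simp: algebra_simps)
  ultimately show ?case unfolding add_Suc_right digit_sums_Suc by blast
qed simp

lemma zero_in_digit_sums [simp]: "0 \<in> digit_sums q n"
  by (induction n) (auto simp: digit_sums_Suc)

lemma digit_sums_mono: "m \<le> n \<Longrightarrow> digit_sums q m \<subseteq> digit_sums q n"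
  using digit_sums_append[of 0 q "n - m" _ m] by auto

lemma finite_digit_sums: "finite (digit_sums q n)"
proof (induction n)
  case (Suc n)
  have "digit_sums q (Suc n) = (\<lambda>y. q * y) ` digit_sums q n \<union> (\<lambda>y. q * y + 1) ` digit_sums q n"
    by (auto simp: digit_sums_Suc)
  with Suc show ?case by simp
qed simp

lemma digit_diffsI:
  "x \<in> digit_sums q n \<Longrightarrow> x' \<in> digit_sums q n \<Longrightarrow> x - x' \<in> digit_diffs q"
  by (auto simp: digit_diffs_def)

lemma digit_diffs_minus: "y \<in> digit_diffs q \<Longrightarrow> - y \<in> digit_diffs q"
  unfolding digit_diffs_def by (auto intro: minus_diff_eq)

lemma horner_in_digit_diffs:
  assumes "\<forall>i. d i \<in> {-1, 0, 1}"
  shows "horner d q n \<in> digit_diffs q"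
proof -
  define s t :: "nat \<Rightarrow> int" where "s i = max (d i) 0" and "t i = max (- d i) 0" for i
  have "s i \<in> {0, 1}" "t i \<in> {0, 1}" for i
    using assms[rule_format, of i] by (auto simp: s_def t_def)
  then have "horner s q n \<in> digit_sums q n" "horner t q n \<in> digit_sums q n"
    by (auto simp: digit_sums_def)
  moreover have "d = (\<lambda>i. s i - t i)" by (auto simp: s_def t_def fun_eq_iff)
  then have "horner d q n = horner s q n - horner t q n" using horner_diff by metis
  ultimately show ?thesis using digit_diffsI by metis
qed

locale base =
  fixes q :: real
  assumes q_gt_1: "q > 1" and q_le_2: "q \<le> 2"
begin

text \<open>The value of the infinite string of digits 1 after the radix point, that is, the sum of
  \<open>1 / q ^ i\<close> over \<open>i \<ge> 1\<close>.\<close>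

definition J :: real where "J = 1 / (q - 1)"

lemma J_ge_1: "J \<ge> 1" and qJ: "q * J = J + 1"
  using q_gt_1 q_le_2 by (auto simp: J_def field_simps)

lemma digit_sums_nonneg: "x \<in> digit_sums q n \<Longrightarrow> x \<ge> 0"
  using q_gt_1 by (induction n arbitrary: x) (auto simp: digit_sums_Suc)

text \<open>Greedy choice of the last digit: a prefix that leaves a remainder in
  \<open>[0, J)\<close> for \<open>t / q\<close> leaves one in \<open>[0, J + 1)\<close> after
  scaling, and since \<open>J \<ge> 1\<close> the digit 0 or 1 brings it back into
  \<open>[0, J)\<close>.\<close>

lemma digit_sums_cover:
  assumes "0 \<le> t" "t < q ^ n * J"
  shows "\<exists>x \<in> digit_sums q n. t - J < x \<and> x \<le> t"
  using assms
proof (induction n arbitrary: t)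
  case (Suc n)
  have "0 \<le> t / q" "t / q < q ^ n * J"
    using Suc.prems q_gt_1 by (auto simp: field_simps)
  then obtain x where x: "x \<in> digit_sums q n" "t / q - J < x" "x \<le> t / q"
    using Suc.IH by blast
  have r: "q * x \<le> t" "t < q * x + J + 1"
    using x q_gt_1 qJ by (auto simp: field_simps)
  show ?case
  proof (cases "t < q * x + J")
    case True
    then show ?thesis
      using x r by (intro bexI[of _ "q * x"]) (auto simp: digit_sums_Suc)
  next
    case False
    then show ?thesis
      using x r J_ge_1 by (intro bexI[of _ "q * x + 1"]) (auto simp: digit_sums_Suc)
  qed
qed (use J_ge_1 in auto)

text \<open>Scaling turns a gap of at most 1 into one of at most \<open>q \<le> 2\<close>; with the
  point \<open>q * a + 1\<close> added, no gap exceeds 1.\<close>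

lemma digit_sums_neighbours:
  assumes "0 \<le> t" "t < (q ^ n - 1) * J"
  shows "\<exists>a \<in> digit_sums q n. \<exists>b \<in> digit_sums q n. a \<le> t \<and> t < b \<and> b \<le> a + 1"
  using assms
proof (induction n arbitrary: t)
  case (Suc n)
  show ?case
  proof (cases "t / q < (q ^ n - 1) * J")
    case True
    moreover have "0 \<le> t / q" using Suc.prems q_gt_1 by simp
    ultimately obtain a b where ab: "a \<in> digit_sums q n" "b \<in> digit_sums q n"
        "a \<le> t / q" "t / q < b" "b \<le> a + 1"
      using Suc.IH by blast
    have r: "q * a \<le> t" "t < q * b" using ab q_gt_1 by (auto simp: field_simps)
    have "q * b \<le> q * (a + 1)" using ab q_gt_1 by (intro mult_left_mono) auto
    then have r3: "q * b \<le> q * a + 1 + 1" using q_le_2 by (simp add: algebra_simps)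
    have mem: "q * a \<in> digit_sums q (Suc n)" "q * a + 1 \<in> digit_sums q (Suc n)"
        "q * b \<in> digit_sums q (Suc n)"
      using ab by (auto simp: digit_sums_Suc)
    show ?thesis
    proof (cases "t < q * a + 1")
      case True
      then show ?thesis using r mem by (intro bexI[of _ "q * a"] bexI[of _ "q * a + 1"]) auto
    next
      case False
      then show ?thesis using r r3 mem by (intro bexI[of _ "q * a + 1"] bexI[of _ "q * b"]) auto
    qed
  next
    case False
    \<comment> \<open>\<open>M\<close> is the value of the all-ones word, the largest of length
      \<open>n\<close>. Beyond \<open>q * M\<close> only the new all-ones value
      \<open>q * M + 1\<close> is left.\<close>
    define M where "M = (q ^ n - 1) * J"
    have M: "M \<in> digit_sums q n"
      unfolding M_def
    proof (induction n)
      case (Suc n)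
      have "(q ^ Suc n - 1) * J = q * ((q ^ n - 1) * J) + (q * J - J)" by (simp add: algebra_simps)
      also have "\<dots> = q * ((q ^ n - 1) * J) + 1" using qJ by simp
      finally show ?case using Suc by (auto simp: digit_sums_Suc)
    qed simp
    have "(q ^ Suc n - 1) * J = q * M + (q * J - J)" by (simp add: M_def algebra_simps)
    then have "t < q * M + 1" using Suc.prems qJ by simp
    moreover have "q * M \<le> t" using False q_gt_1 by (auto simp: M_def field_simps)
    moreover have "q * M \<in> digit_sums q (Suc n)" "q * M + 1 \<in> digit_sums q (Suc n)"
      using M by (auto simp: digit_sums_Suc)
    ultimately show ?thesis
      by (intro bexI[of _ "q * M"] bexI[of _ "q * M + 1"]) auto
  qed
qed simp

lemma digit_sums_le: "x \<in> digit_sums q n \<Longrightarrow> x \<le> (q ^ n - 1) * J"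
proof (induction n arbitrary: x)
  case (Suc n)
  then obtain y where y: "y \<in> digit_sums q n" "x \<le> q * y + 1" by (auto simp: digit_sums_Suc)
  have "q * y \<le> q * ((q ^ n - 1) * J)" using Suc.IH[OF y(1)] q_gt_1 by (intro mult_left_mono) auto
  then have "x \<le> q * ((q ^ n - 1) * J) + (q * J - J)" using y qJ by simp
  then show ?case by (simp add: algebra_simps)
qed simp

end

section \<open>Local finiteness of the digit differences\<close>

lemma (in base) finite_digit_diffs_unit:
  assumes q2: "q < 2" and mu: "\<mu> > 0"
    and sep: "\<And>y. y \<in> digit_diffs q \<Longrightarrow> y \<noteq> 0 \<Longrightarrow> \<mu> \<le> \<bar>y\<bar>"
  shows "finite (digit_diffs q \<inter> {-1..1})"
proof -
  have J1: "J > 1" using q_gt_1 q2 by (simp add: J_def)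
  define C where "C n t = {x \<in> digit_sums q n. t - J < x \<and> x \<le> t}" for n t
  have finC: "finite (C n t)" for n t by (simp add: C_def finite_digit_sums)
  \<comment> \<open>Points of a window are at least \<open>\<mu>\<close> apart, so each cell of
    length \<open>\<mu>\<close> holds at most one of them; the bound does not depend on
    \<open>n\<close> or \<open>t\<close>, whence a fullest window exists.\<close>
  have card_le: "card (C n t) \<le> nat \<lceil>J / \<mu>\<rceil> + 1" for n t
  proof -
    define g where "g x = nat \<lfloor>(x - (t - J)) / \<mu>\<rfloor>" for x
    have "inj_on g (C n t)"
    proof (rule inj_onI, rule ccontr)
      fix x y assume xy: "x \<in> C n t" "y \<in> C n t" "g x = g y" "x \<noteq> y"
      have "\<mu> \<le> \<bar>x - y\<bar>" using xy digit_diffsI sep by (force simp: C_def)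
      moreover have "\<lfloor>(x - (t - J)) / \<mu>\<rfloor> = \<lfloor>(y - (t - J)) / \<mu>\<rfloor>"
        using xy mu by (simp add: g_def C_def nat_eq_iff)
      then have "\<bar>(x - (t - J)) / \<mu> - (y - (t - J)) / \<mu>\<bar> < 1" by linarith
      then have "\<bar>x - y\<bar> / \<mu> < 1" using mu by (simp flip: diff_divide_distrib)
      then have "\<bar>x - y\<bar> < \<mu>" using mu by (simp add: field_simps)
      ultimately show False by simp
    qed
    moreover have "g ` C n t \<subseteq> {..nat \<lceil>J / \<mu>\<rceil>}"
    proof
      fix k assume "k \<in> g ` C n t"
      then obtain x where x: "x \<in> C n t" "k = g x" by blast
      have "(x - (t - J)) / \<mu> \<le> J / \<mu>" using x mu by (simp add: C_def divide_right_mono)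
      then have "\<lfloor>(x - (t - J)) / \<mu>\<rfloor> \<le> \<lceil>J / \<mu>\<rceil>" by linarith
      then show "k \<in> {..nat \<lceil>J / \<mu>\<rceil>}" using x by (simp add: g_def nat_mono)
    qed
    ultimately have "card (C n t) \<le> card {..nat \<lceil>J / \<mu>\<rceil>}"
      by (meson card_inj_on_le finite_atMost)
    then show ?thesis by simp
  qed
  have "\<exists>x. True \<and> (\<forall>y. True \<longrightarrow> card (C (fst y) (snd y)) \<le> card (C (fst x) (snd x)))"
    using card_le by (intro ex_has_greatest_nat[of _ _ _ "nat \<lceil>J / \<mu>\<rceil> + 2"]) (auto simp: le_imp_less_Suc)
  then obtain n0 t where max: "\<And>n s. card (C n s) \<le> card (C n0 t)" by auto
  define K where "K = card (C n0 t)"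
  have K_ge: "card (C n s) \<le> K" for n s by (simp add: K_def max)
  have t: "card (C n0 t) = K" by (simp add: K_def)
  have "0 \<in> C 0 0" using J1 by (simp add: C_def)
  then have "card (C 0 0) > 0" using finC card_gt_0_iff by blast
  then have "K > 0" using K_ge[of 0 0] by simp
  then have "C n0 t \<noteq> {}" using t by auto
  then have t0: "t \<ge> 0" using digit_sums_nonneg by (force simp: C_def)
  \<comment> \<open>\<open>k\<close> is so large that \<open>q ^ k * y + t < q ^ k * J\<close> for
    every \<open>y \<le> 1\<close>, which is possible since \<open>J > 1\<close>. Leading zeros keep
    the shorter words available, so at length \<open>k\<close> the window is still a fullest
    one.\<close>
  obtain k0 where k0: "t / (J - 1) < q ^ k0" using real_arch_pow[OF q_gt_1] by blast
  define k where "k = max n0 k0"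
  have "q ^ k0 \<le> q ^ k" using q_gt_1 by (intro power_increasing) (auto simp: k_def)
  with k0 have "t / (J - 1) < q ^ k" by simp
  then have k: "t < q ^ k * (J - 1)" using J1 by (simp add: field_simps)
  have "C n0 t \<subseteq> C k t" using digit_sums_mono[of n0 k q] by (auto simp: C_def k_def)
  then have cardk: "card (C k t) = K" using t K_ge card_mono[OF finC] by (metis le_antisym)
  \<comment> \<open>Words with another prefix may fall into this window, but the translated content
    already has \<open>K\<close> elements, so they contribute no new value.\<close>
  have window: "C (j + k) (q ^ k * v + t) = (\<lambda>x. q ^ k * v + x) ` C k t"
    if v: "v \<in> digit_sums q j" for j v
  proof (rule sym, rule card_subset_eq[OF finC])
    show "(\<lambda>x. q ^ k * v + x) ` C k t \<subseteq> C (j + k) (q ^ k * v + t)"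
      using digit_sums_append[OF v] by (auto simp: C_def)
    have "card ((\<lambda>x. q ^ k * v + x) ` C k t) = K" by (simp add: card_image cardk)
    moreover have "K \<le> card (C (j + k) (q ^ k * v + t))"
      using calculation \<open>_ \<subseteq> C (j + k) _\<close> card_mono[OF finC] by metis
    ultimately show "card ((\<lambda>x. q ^ k * v + x) ` C k t) = card (C (j + k) (q ^ k * v + t))"
      using K_ge by (metis le_antisym)
  qed
  define F where "F = (\<lambda>(p, s). (p - s) / q ^ k) ` (digit_sums q k \<times> digit_sums q k)"
  have finF: "finite F" by (simp add: F_def finite_digit_sums)
  have pos: "y \<in> F" if y: "y \<in> digit_diffs q" "0 \<le> y" "y \<le> 1" for y
  proof -
    obtain j z z' where z: "z \<in> digit_sums q j" "z' \<in> digit_sums q j" "y = z - z'"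
      using y(1) by (auto simp: digit_diffs_def)
    have "q ^ k * y \<le> q ^ k * 1" using y q_gt_1 by (intro mult_left_mono) auto
    then have "q ^ k * y + t < q ^ k * J" using k by (simp add: algebra_simps)
    moreover have "0 \<le> q ^ k * y + t" using y q_gt_1 t0 by simp
    ultimately obtain s where s: "s \<in> digit_sums q k"
        "q ^ k * y + t - J < s" "s \<le> q ^ k * y + t"
      using digit_sums_cover by blast
    have y_eq: "q ^ k * y = q ^ k * z - q ^ k * z'" using z by (simp add: right_diff_distrib)
    \<comment> \<open>The word of \<open>z'\<close>, continued by that of \<open>s\<close>, ends in
      the window of \<open>z\<close>. Its value is therefore that of \<open>z\<close> followed by
      some \<open>p\<close>, and \<open>y\<close> is a scaled difference of two values of length
      \<open>k\<close>.\<close>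
    with s have "q ^ k * z' + s \<in> C (j + k) (q ^ k * z + t)"
      using digit_sums_append[OF z(2) s(1)] by (auto simp: C_def)
    then obtain p where p: "p \<in> digit_sums q k" "q ^ k * z' + s = q ^ k * z + p"
      unfolding window[OF z(1)] by (auto simp: C_def)
    then have "q ^ k * y = s - p" using y_eq by simp
    then have "y = (s - p) / q ^ k" using q_gt_1 by (simp add: field_simps)
    then show ?thesis using s p by (auto simp: F_def)
  qed
  have "y \<in> F \<union> uminus ` F" if "y \<in> digit_diffs q \<inter> {-1..1}" for y
    using that pos[of y] pos[of "- y"] digit_diffs_minus[of y q]
    by (cases "y \<ge> 0") (auto simp: image_iff intro: bexI[of _ "- y"])
  then have "digit_diffs q \<inter> {-1..1} \<subseteq> F \<union> uminus ` F" by blast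
  then show ?thesis using finF finite_subset by blast
qed

text \<open>The neighbours \<open>a \<le> y - 1 < b\<close> split off from \<open>y - x\<close> the
  differences \<open>y - b\<close> and \<open>b - a\<close>, both at most 1, and leave
  \<open>a - x\<close>, which is smaller by at least 1.\<close>

lemma (in base) finite_digit_diffs_bounded:
  assumes fin: "finite (digit_diffs q \<inter> {-1..1})"
  shows "finite (digit_diffs q \<inter> {-R..R})"
proof -
  let ?U = "digit_diffs q \<inter> {-1..1}"
  \<comment> \<open>\<open>F N\<close> consists of the sums of \<open>2 * N + 1\<close> elements of
    \<open>?U\<close>: two for each descent and one for the rest.\<close>
  define F where "F N = ((\<lambda>A. {u + v + w | u v w. u \<in> ?U \<and> v \<in> ?U \<and> w \<in> A}) ^^ N) ?U" for N
  have F_Suc: "F (Suc N) = (\<lambda>(u, v, w). u + v + w) ` (?U \<times> ?U \<times> F N)" for N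
    by (force simp: F_def)
  have finF: "finite (F N)" for N
    by (induction N) (use fin in \<open>simp_all add: F_Suc, simp add: F_def\<close>)
  have U0: "0 \<in> ?U" using digit_diffsI[of 0 q 0 0] by simp
  have step: "u + v + w \<in> F (Suc N)" if "u \<in> ?U" "v \<in> ?U" "w \<in> F N" for u v w N
    unfolding F_Suc using that by (intro image_eqI[of _ _ "(u, v, w)"]) auto
  have UF: "u \<in> F N" if "u \<in> ?U" for u N
  proof (induction N)
    case 0
    show ?case using that by (simp add: F_def)
  next
    case (Suc N)
    then show ?case using step[OF U0 U0 Suc] by simp
  qed
  have main: "y - x \<in> F N"
    if "x \<in> digit_sums q n" "y \<in> digit_sums q n" "x \<le> y" "y - x \<le> real N" for x y n N
    using that
  proof (induction N arbitrary: x y)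
    case 0
    then show ?case using UF[OF U0, of 0] by simp
  next
    case (Suc N)
    show ?case
    proof (cases "y - x \<le> 1")
      case True
      then show ?thesis using Suc.prems digit_diffsI[of y q n x] by (intro UF) auto
    next
      case False
      have "0 \<le> x" using Suc.prems digit_sums_nonneg by blast
      moreover have "y \<le> (q ^ n - 1) * J" using Suc.prems digit_sums_le by blast
      ultimately obtain a b where ab: "a \<in> digit_sums q n" "b \<in> digit_sums q n"
          "a \<le> y - 1" "y - 1 < b" "b \<le> a + 1"
        using digit_sums_neighbours[of "y - 1" n] False by auto
      have yb: "y - b \<in> ?U" using ab digit_diffsI[of y q n b] Suc.prems by auto
      show ?thesis
      proof (cases "x \<le> a")
        case True
        have "a - x \<in> F N" using ab Suc True by (intro Suc.IH) auto
        moreover have "b - a \<in> ?U" using ab digit_diffsI[of b q n a] by auto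
        ultimately show ?thesis using step[OF yb, of "b - a" "a - x" N] by simp
      next
        case not_le: False
        have "b - x \<in> ?U" using ab digit_diffsI[of b q n x] Suc.prems False not_le by auto
        then show ?thesis using step[OF yb _ UF[OF U0], of "b - x" N] by simp
      qed
    qed
  qed
  obtain N :: nat where N: "R \<le> real N" using real_arch_simple by blast
  have "y \<in> F N \<union> uminus ` F N" if y: "y \<in> digit_diffs q \<inter> {-R..R}" for y
  proof -
    obtain n x x' where x: "x \<in> digit_sums q n" "x' \<in> digit_sums q n" "y = x - x'"
      using y by (auto simp: digit_diffs_def)
    show ?thesis
    proof (cases "x' \<le> x")
      case True
      then show ?thesis using main[of x' n x N] x y N by simp
    next
      case False
      then have "- y \<in> F N" using main[of x n x' N] x y N by simp
      then show ?thesis by (auto intro: image_eqI[of _ _ "- y"])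
    qed
  qed
  then have "digit_diffs q \<inter> {-R..R} \<subseteq> F N \<union> uminus ` F N" by blast
  then show ?thesis using finF finite_subset by blast
qed

section \<open>Signed expansions and their conjugates\<close>

lemma rpoly_horner: "rpoly (horner d [:0, 1:] n) z = horner d z n"
  by (induction n) (simp_all add: of_int_poly)

lemma conj_pair_horner:
  assumes "conj_pair x w"
  shows "horner d x n = horner e x m \<longleftrightarrow> horner d w n = horner e w m"
  using conj_pair_eq_iff[OF assms, of "horner d [:0, 1:] n" "horner e [:0, 1:] m"]
  by (simp add: rpoly_horner)

lemma conj_pair_not_root_of_unity:
  assumes "conj_pair x w" "x > 1" "n > 0"
  shows "w ^ n \<noteq> 1"
proof
  assume "w ^ n = 1"
  then have "rpoly ([:0, 1:] ^ n) w = rpoly 1 w" by simp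
  then have "rpoly ([:0, 1:] ^ n) x = rpoly 1 x" using conj_pair_eq_iff[OF assms(1)] by blast
  then have "x ^ n = 1" by simp
  then show False using assms one_less_power[of x n] by simp
qed

lemma conj_pair_nonzero:
  assumes "conj_pair x w" "x \<noteq> 0"
  shows "w \<noteq> 0"
  using assms(1)[unfolded conj_pair_def, rule_format, of "[:0, 1:]"] assms(2) by auto

context base
begin

text \<open>Index 0 stands for the first digit after the radix point, whose weight is
  \<open>1 / q\<close>; hence the exponents \<open>Suc i\<close> throughout.\<close>

definition geom :: "nat \<Rightarrow> real" where "geom i = (1 / q) ^ Suc i"

lemma geom_pos: "geom i > 0"
  using q_gt_1 by (simp add: geom_def)

lemma geom_sums: "geom sums J"
proof -
  have "(\<lambda>i. (1 / q) * (1 / q) ^ i) sums ((1 / q) * (1 / (1 - 1 / q)))"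
    using q_gt_1 by (intro sums_mult geometric_sums) auto
  moreover have "(1 / q) * (1 / (1 - 1 / q)) = J"
    using q_gt_1 by (simp add: J_def field_simps)
  ultimately show ?thesis by (simp add: geom_def[abs_def])
qed

lemma geom_subset_summable: "summable (\<lambda>i. if i \<in> N then geom i else 0)"
  by (rule summable_comparison_test'[OF sums_summable[OF geom_sums], of 0])
    (use geom_pos in \<open>auto simp: less_imp_le\<close>)

text \<open>The largest value of a 0-1 expansion supported on \<open>N\<close>; its negative is the
  smallest value with digits -1, 0 there.\<close>

definition weight :: "nat set \<Rightarrow> real" where
  "weight N = (\<Sum>i. if i \<in> N then geom i else 0)"

lemma weight_sums: "(\<lambda>i. if i \<in> N then geom i else 0) sums weight N"
  unfolding weight_def using geom_subset_summable by (rule summable_sums)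

lemma weight_Compl: "weight (- N) = J - weight N"
proof -
  have "(\<lambda>i. geom i - (if i \<in> N then geom i else 0)) sums (J - weight N)"
    by (intro sums_diff geom_sums weight_sums)
  moreover have "(\<lambda>i. geom i - (if i \<in> N then geom i else 0)) = (\<lambda>i. if i \<in> - N then geom i else 0)"
    by auto
  ultimately show ?thesis using weight_sums[of "- N"] sums_unique2 by metis
qed

lemma sum_le_weight:
  assumes "finite F" "F \<subseteq> N"
  shows "sum geom F \<le> weight N"
proof -
  have "sum geom F = (\<Sum>i\<in>F. if i \<in> N then geom i else 0)"
    using assms by (intro sum.cong) auto
  also have "\<dots> \<le> weight N"
    unfolding weight_def using assms geom_pos geom_subset_summable
    by (intro sum_le_suminf) (auto simp: less_imp_le)
  finally show ?thesis .
qed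

text \<open>The lazy algorithm: the digit 1 is taken only if the scaled remainder exceeds
  \<open>J\<close>. The remainder stays in \<open>[0, J]\<close> because \<open>J \<ge> 1\<close>
  and \<open>q * J = J + 1\<close>.\<close>

lemma digit_expansion:
  assumes "0 \<le> x" "x \<le> J"
  shows "\<exists>c :: nat \<Rightarrow> int. (\<forall>i. c i \<in> {0, 1}) \<and> (\<lambda>i. of_int (c i) * geom i) sums x"
proof -
  define r where "r = rec_nat x (\<lambda>_ r. if q * r \<le> J then q * r else q * r - 1)"
  define c :: "nat \<Rightarrow> int" where "c n = (if q * r n \<le> J then 0 else 1)" for n
  have r0: "r 0 = x" and rS: "r (Suc n) = q * r n - of_int (c n)" for n
    by (simp_all add: r_def c_def)
  have r: "0 \<le> r n \<and> r n \<le> J" for n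
  proof (induction n)
    case (Suc n)
    then have "0 \<le> q * r n" "q * r n \<le> q * J" using q_gt_1 by auto
    then show ?case using J_ge_1 qJ by (auto simp: rS c_def)
  qed (use assms r0 in auto)
  have part: "(\<Sum>i<n. of_int (c i) * geom i) = x - r n * (1 / q) ^ n" for n
  proof (induction n)
    case (Suc n)
    have "q * (1 / q) ^ Suc n = (1 / q) ^ n" using q_gt_1 by simp
    then have "(q * r n - of_int (c n)) * (1 / q) ^ Suc n = r n * (1 / q) ^ n - of_int (c n) * geom n"
      by (simp only: geom_def left_diff_distrib mult.assoc mult.left_commute[of q "r n"])
    then show ?case using Suc by (simp only: sum.lessThan_Suc rS)
  qed (use r0 in simp)
  have "(\<lambda>n. r n * (1 / q) ^ n) \<longlonglongrightarrow> 0"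
  proof (rule Lim_null_comparison)
    show "\<forall>\<^sub>F n in sequentially. norm (r n * (1 / q) ^ n) \<le> J * (1 / q) ^ n"
      using r q_gt_1 by (intro always_eventually) (auto intro!: divide_right_mono simp: field_simps)
    show "(\<lambda>n. J * (1 / q) ^ n) \<longlonglongrightarrow> 0"
      using q_gt_1 by (intro tendsto_mult_right_zero LIMSEQ_power_zero) auto
  qed
  then have "(\<lambda>n. x - r n * (1 / q) ^ n) \<longlonglongrightarrow> x - 0" by (intro tendsto_intros)
  then have "(\<lambda>i. of_int (c i) * geom i) sums x" by (simp add: sums_def part)
  then show ?thesis by (intro exI[of _ c]) (auto simp: c_def)
qed

text \<open>Adding \<open>weight N\<close> reduces this to digits 0 and 1; subtracting 1 from the
  digits on \<open>N\<close> undoes the shift.\<close>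

lemma signed_digit_expansion:
  assumes "- weight N \<le> y" "y \<le> weight (- N)"
  shows "\<exists>d :: nat \<Rightarrow> int. (\<forall>i \<in> N. d i \<in> {-1, 0}) \<and> (\<forall>i \<in> - N. d i \<in> {0, 1}) \<and>
    (\<lambda>i. of_int (d i) * geom i) sums y"
proof -
  obtain c :: "nat \<Rightarrow> int" where c: "\<forall>i. c i \<in> {0, 1}"
      "(\<lambda>i. of_int (c i) * geom i) sums (y + weight N)"
    using digit_expansion[of "y + weight N"] assms by (auto simp: weight_Compl)
  define d where "d i = (if i \<in> N then c i - 1 else c i)" for i
  have "(\<lambda>i. of_int (c i) * geom i - (if i \<in> N then geom i else 0)) sums (y + weight N - weight N)"
    by (intro sums_diff c weight_sums)
  moreover have "(\<lambda>i. of_int (c i) * geom i - (if i \<in> N then geom i else 0)) =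
      (\<lambda>i. of_int (d i) * geom i)"
    by (auto simp: d_def fun_eq_iff algebra_simps)
  ultimately have "(\<lambda>i. of_int (d i) * geom i) sums y" by simp
  moreover have "d i \<in> {-1, 0}" if "i \<in> N" for i using c(1)[rule_format, of i] that by (auto simp: d_def)
  moreover have "d i \<in> {0, 1}" if "i \<in> - N" for i using c(1) that by (auto simp: d_def)
  ultimately show ?thesis by blast
qed

end

text \<open>The remainder of an expansion after \<open>n\<close> digits, scaled by
  \<open>z ^ n\<close>, is again the value of a word: \<open>e\<close> continued with the negated
  digits. So remainders stay among the digit differences and can be transported to a
  conjugate.\<close>

lemma horner_append:
  fixes z :: "'a::field"
  assumes "z \<noteq> 0"
  shows "horner (\<lambda>i. if i < m then e i else - d (i - m)) z (m + n) =
    z ^ n * (horner e z m - (\<Sum>i<n. of_int (d i) * (1 / z) ^ Suc i))"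
proof (induction n)
  case 0
  show ?case by (auto intro: horner_cong)
next
  case (Suc n)
  have "z ^ Suc n * (1 / z) ^ Suc n = 1"
    using assms by (simp only: power_mult_distrib[symmetric]) simp
  then have "z ^ Suc n * (S + of_int a * (1 / z) ^ Suc n) = z ^ Suc n * S + of_int a" for S a
    by (simp only: distrib_left mult.left_commute[of "z ^ Suc n" "of_int a"]) simp
  with Suc show ?case
    by (simp only: sum.lessThan_Suc right_diff_distrib add_Suc_right horner.simps) (simp add: algebra_simps)
qed

section \<open>Remainders of expansions and their conjugates\<close>

locale loc_finite_base = base +
  assumes fin: "finite (digit_diffs q \<inter> {-R..R})"
begin

definition expands :: "(nat \<Rightarrow> int) \<Rightarrow> (nat \<Rightarrow> int) \<Rightarrow> nat \<Rightarrow> bool" where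
  "expands d e m \<longleftrightarrow> (\<forall>i. e i \<in> {-1, 0, 1}) \<and> (\<forall>i. d i \<in> {-1, 0, 1}) \<and>
     (\<lambda>i. of_int (d i) * geom i) sums horner e q m"

text \<open>Defined over any field, as the remainders at \<open>q\<close> and at a conjugate are
  compared.\<close>

definition tail_state :: "(nat \<Rightarrow> int) \<Rightarrow> (nat \<Rightarrow> int) \<Rightarrow> nat \<Rightarrow> nat \<Rightarrow> 'a::field \<Rightarrow> 'a" where
  "tail_state d e m n z = z ^ n * (horner e z m - (\<Sum>i<n. of_int (d i) * (1 / z) ^ Suc i))"

lemma tail_state_horner:
  "z \<noteq> 0 \<Longrightarrow> tail_state d e m n z = horner (\<lambda>i. if i < m then e i else - d (i - m)) z (m + n)"
  by (simp add: tail_state_def horner_append)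

lemma tail_state_Suc: "z \<noteq> 0 \<Longrightarrow> tail_state d e m (Suc n) z = z * tail_state d e m n z - of_int (d n)"
  by (simp add: tail_state_horner)

lemma tail_state_in:
  assumes "expands d e m"
  shows "tail_state d e m n q \<in> digit_diffs q \<inter> {-J..J}"
proof
  have "\<forall>i. (if i < m then e i else - d (i - m)) \<in> {-1, 0, 1}"
    using assms by (force simp: expands_def)
  then show "tail_state d e m n q \<in> digit_diffs q"
    using q_gt_1 by (simp add: tail_state_horner horner_in_digit_diffs del: insert_iff)
  have "(\<lambda>i. of_int (d (i + n)) * geom (i + n)) sums (horner e q m - (\<Sum>i<n. of_int (d i) * geom i))"
    using assms by (intro sums_split_initial_segment) (simp add: expands_def)
  then have s: "(\<lambda>i. q ^ n * (of_int (d (i + n)) * geom (i + n))) sums tail_state d e m n q"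
    unfolding tail_state_def geom_def[symmetric] by (rule sums_mult)
  have "q ^ n * (of_int (d (i + n)) * geom (i + n)) = of_int (d (i + n)) * geom i" for i
    using q_gt_1 by (simp add: geom_def power_add field_simps)
  with s have s: "(\<lambda>i. of_int (d (i + n)) * geom i) sums tail_state d e m n q" by simp
  have d: "\<bar>of_int (d i) :: real\<bar> \<le> 1" for i
    using assms by (auto simp: expands_def dest!: spec[of _ i])
  have "of_int (d (i + n)) * geom i \<le> geom i" "- geom i \<le> of_int (d (i + n)) * geom i" for i
    using mult_right_mono[of "of_int (d (i + n))" 1 "geom i"] mult_right_mono[of "-1" "of_int (d (i + n))" "geom i"]
      d[of "i + n"] geom_pos[of i] by (auto simp: abs_le_iff)
  then have "tail_state d e m n q \<le> J" "- J \<le> tail_state d e m n q"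
    using s geom_sums sums_minus[OF geom_sums] by (meson sums_le)+
  then show "tail_state d e m n q \<in> {-J..J}" by simp
qed

text \<open>Equal remainders at \<open>q\<close> give equal remainders at \<open>w\<close>, so the
  latter are a function of the former, which take only finitely many values.\<close>

lemma tail_state_bounded:
  assumes ex: "expands d e m" and w: "conj_pair q w"
  obtains C where "\<And>n. norm (tail_state d e m n w) \<le> C"
proof -
  let ?f = "\<lambda>n. tail_state d e m n q" and ?g = "\<lambda>n. tail_state d e m n w"
  have w0: "w \<noteq> 0" using conj_pair_nonzero[OF w] q_gt_1 by simp
  have fg: "?g n = ?g k" if "?f n = ?f k" for n k
    using that conj_pair_horner[OF w] q_gt_1 w0 by (simp add: tail_state_horner)
  define h where "h s = ?g (SOME k. ?f k = s)" for s
  have "?g n = h (?f n)" for n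
    unfolding h_def using someI[of "\<lambda>k. ?f k = ?f n" n] by (intro fg) simp
  then have "range ?g \<subseteq> h ` (digit_diffs q \<inter> {-J..J})"
    using tail_state_in[OF ex] by blast
  then have "bounded (range ?g)" using fin finite_imp_bounded finite_subset finite_imageI by metis
  then show thesis using that by (auto simp: bounded_iff)
qed

text \<open>The error of the \<open>n\<close>-th partial sum is a bounded remainder divided by
  \<open>w ^ n\<close>.\<close>

lemma expansion_conj_sums:
  assumes ex: "expands d e m" and w: "conj_pair q w" "norm w > 1"
  shows "(\<lambda>i. of_int (d i) * (1 / w) ^ Suc i) sums horner e w m"
proof -
  obtain C where C: "\<And>n. norm (tail_state d e m n w) \<le> C"
    using tail_state_bounded[OF ex w(1)] by blast
  have "(\<lambda>n. tail_state d e m n w * (1 / w) ^ n) \<longlonglongrightarrow> 0"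
  proof (rule Lim_null_comparison)
    show "\<forall>\<^sub>F n in sequentially. norm (tail_state d e m n w * (1 / w) ^ n) \<le> C * (1 / norm w) ^ n"
      by (intro always_eventually)
        (auto simp: norm_mult norm_power norm_divide intro!: mult_right_mono divide_right_mono C)
    show "(\<lambda>n. C * (1 / norm w) ^ n) \<longlonglongrightarrow> 0"
      using w by (intro tendsto_mult_right_zero LIMSEQ_power_zero) (simp add: divide_less_eq)
  qed
  then have "(\<lambda>n. horner e w m - tail_state d e m n w * (1 / w) ^ n) \<longlonglongrightarrow> horner e w m - 0"
    by (intro tendsto_intros)
  moreover have "w \<noteq> 0" using w by auto
  then have "horner e w m - tail_state d e m n w * (1 / w) ^ n = (\<Sum>i<n. of_int (d i) * (1 / w) ^ Suc i)" for n
    by (simp add: tail_state_def power_divide field_simps)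
  ultimately show ?thesis by (simp add: sums_def)
qed

end

section \<open>Multinacci numbers and small digit differences\<close>

lemma geometric_ratio_strict_mono:
  fixes a b :: real
  assumes "0 < a" "a < b" "n > 0"
  shows "(\<Sum>i<n. b ^ i) * a ^ n < b ^ n * (\<Sum>i<n. a ^ i)"
  unfolding sum_distrib_right sum_distrib_left
proof (rule sum_strict_mono)
  fix i assume i: "i \<in> {..<n}"
  then have "a ^ n = a ^ i * a ^ (n - i)" "b ^ n = b ^ i * b ^ (n - i)"
    by (simp_all flip: power_add)
  moreover have "a ^ (n - i) < b ^ (n - i)"
    using i assms by (intro power_strict_mono) auto
  ultimately show "b ^ i * a ^ n < b ^ n * a ^ i"
    using assms by (simp add: mult.assoc mult.left_commute)
qed (use assms in auto)

text \<open>The equation gives \<open>w ^ n * (2 - w) = 1\<close>, whereas for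
  \<open>r = norm w\<close> the bound \<open>r ^ n \<le> (\<Sum>i<n. r ^ i)\<close> yields
  \<open>r ^ n * (2 - r) \<ge> 1\<close>. So \<open>2 - r \<le> norm (2 - w)\<close> is an equality
  and \<open>w\<close> is the positive number \<open>r\<close>. The equation has only one positive
  root, since \<open>(\<Sum>i<n. x ^ i) / x ^ n\<close> decreases strictly.\<close>

lemma multinacci_conj:
  assumes q: "1 < q" and n: "n > 0" "q ^ n = (\<Sum>i<n. q ^ i)"
    and w: "w ^ n = (\<Sum>i<n. w ^ i)" "norm w \<ge> 1" "w \<noteq> (1 :: complex)"
  shows "w = of_real q"
proof -
  define r where "r = norm w"
  have r1: "r \<ge> 1" using w by (simp add: r_def)
  have w_eq: "w ^ n * (2 - w) = 1"
  proof -
    have "w ^ n * (w - 1) = w ^ n - 1"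
      using power_diff_1_eq[of w n] w(1) by (simp add: mult.commute)
    then show ?thesis by (simp add: algebra_simps)
  qed
  have "r ^ n \<le> (\<Sum>i<n. r ^ i)"
    using norm_sum[of "\<lambda>i. w ^ i" "{..<n}"] w(1) by (simp add: r_def norm_power flip: norm_power)
  have rq: "r \<le> q"
  proof (rule ccontr)
    assume "\<not> r \<le> q"
    then have "(\<Sum>i<n. r ^ i) * q ^ n < r ^ n * q ^ n"
      using geometric_ratio_strict_mono[of q r n] n q by simp
    with \<open>r ^ n \<le> _\<close> q show False by simp
  qed
  have geq: "r ^ n * (2 - r) = 1 + (r - 1) * ((\<Sum>i<n. r ^ i) - r ^ n)"
    using power_diff_1_eq[of r n] by (simp add: algebra_simps)
  have "2 - r \<le> norm (2 - w)" using norm_triangle_ineq2[of 2 w] by (simp add: r_def)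
  have nw: "r ^ n * norm (2 - w) = 1"
    using arg_cong[OF w_eq, of norm] by (simp add: r_def norm_mult norm_power)
  have "r ^ n * (2 - r) \<le> r ^ n * norm (2 - w)"
    using \<open>2 - r \<le> _\<close> r1 by (intro mult_left_mono) auto
  moreover have "0 \<le> (r - 1) * ((\<Sum>i<n. r ^ i) - r ^ n)"
    using r1 \<open>r ^ n \<le> _\<close> by simp
  ultimately have eq: "r ^ n * (2 - r) = r ^ n * norm (2 - w)" and z: "(r - 1) * ((\<Sum>i<n. r ^ i) - r ^ n) = 0"
    using nw geq by linarith+
  have n2: "norm (2 - w) = 2 - r" using eq r1 by simp
  have "Re w = r"
  proof -
    have "(2 - r)\<^sup>2 = (2 - Re w)\<^sup>2 + (Im w)\<^sup>2"
      using n2 by (simp add: cmod_def flip: n2)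
    moreover have "r\<^sup>2 = (Re w)\<^sup>2 + (Im w)\<^sup>2" by (simp add: r_def cmod_power2)
    ultimately show ?thesis by (simp add: power2_eq_square algebra_simps)
  qed
  moreover have "r\<^sup>2 = (Re w)\<^sup>2 + (Im w)\<^sup>2" by (simp add: r_def cmod_power2)
  ultimately have w_r: "w = of_real r" by (simp add: complex_eq_iff)
  with w(3) z have "(\<Sum>i<n. r ^ i) = r ^ n" by auto
  then have "\<not> r < q" using geometric_ratio_strict_mono[of r q n] n r1 by auto
  with rq w_r show ?thesis by simp
qed

context base
begin

text \<open>The bound matches the weights in \<open>weight_ge_one_two\<close>,
  \<open>weight_ge_odd\<close> and \<open>weight_ge_zero\<close>. The candidates come from the words
  1, -1, -1, ..., whose values \<open>y n\<close> start at 1 and tend to minus infinity because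
  \<open>q < 2\<close>.\<close>

lemma small_digit_diff:
  assumes q2: "q < 2"
  shows "(\<exists>e m. (\<forall>i. e i \<in> {-1, 0, 1}) \<and> horner e q m \<noteq> 0 \<and> \<bar>horner e q m\<bar> \<le> max (1 / 3) (1 / q\<^sup>2)) \<or>
    (\<exists>n > 0. q ^ n = (\<Sum>i<n. q ^ i))"
proof (cases "3 * q \<le> 4")
  case True
  define e :: "nat \<Rightarrow> int" where "e i = (if i = 0 then 1 else -1)" for i
  have "horner e q 2 = q - 1" by (simp add: e_def numeral_2_eq_2)
  moreover have "\<forall>i. e i \<in> {-1, 0, 1}" by (simp add: e_def)
  ultimately show ?thesis using True q_gt_1
    by (intro disjI1 exI[of _ e] exI[of _ 2] conjI) (auto simp: le_max_iff_disj)
next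
  case False
  define e :: "nat \<Rightarrow> int" where "e i = (if i = 0 then 1 else -1)" for i
  define y where "y n = horner e q (Suc n)" for n
  have y0: "y 0 = 1" and yS: "y (Suc n) = q * y n - 1" for n by (simp_all add: y_def e_def)
  have y_sum: "y n = q ^ n - (\<Sum>i<n. q ^ i)" for n
  proof (induction n)
    case (Suc n)
    have "(\<Sum>i<Suc n. q ^ i) = 1 + q * (\<Sum>i<n. q ^ i)"
      by (simp add: sum.lessThan_Suc_shift sum_distrib_left del: sum.lessThan_Suc)
    moreover have "y (Suc n) = q * q ^ n - q * (\<Sum>i<n. q ^ i) - 1"
      by (simp only: yS Suc right_diff_distrib)
    ultimately show ?case by simp
  qed (simp add: y0)
  have y_closed: "y n = J - (J - 1) * q ^ n" for n
  proof (induction n)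
    case (Suc n)
    have "q * (J - (J - 1) * q ^ n) - 1 = (q * J - 1) - (J - 1) * (q * q ^ n)" by (simp add: algebra_simps)
    then show ?case using Suc qJ by (simp add: yS)
  qed (simp add: y0)
  have J1: "J > 1" using q_gt_1 q2 by (simp add: J_def)
  obtain n where n: "J / (J - 1) < q ^ n" using real_arch_pow[OF q_gt_1] by blast
  then have "y n < 0" using J1 by (simp add: y_closed field_simps)
  then have ex: "\<exists>n. 3 * q * y n \<le> 4" using q_gt_1 by (intro exI[of _ n]) (smt (verit) mult_pos_neg)
  \<comment> \<open>At the first such index \<open>q * y k \<le> 4 / 3\<close>, while
    \<open>q\<close> times the preceding value exceeds \<open>4 / 3\<close>, so that
    \<open>y k > 1 / 3\<close>.\<close>
  define k where "k = (LEAST n. 3 * q * y n \<le> 4)"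
  have k: "3 * q * y k \<le> 4" unfolding k_def using ex by (rule LeastI_ex)
  then obtain k' where k': "k = Suc k'" using y0 False by (cases k) auto
  have "\<not> 3 * q * y k' \<le> 4" using not_less_Least[of k' "\<lambda>n. 3 * q * y n \<le> 4"] k' k_def by simp
  then have third: "y k > 1 / 3" by (simp add: k' yS)
  define e' where "e' b = e(Suc k := b)" for b :: int
  define e'' where "e'' = e(Suc k := 0)"
  have dig: "\<forall>i. e i \<in> {-1, 0, 1}" "\<forall>i. e'' i \<in> {-1, 0, 1}" by (auto simp: e_def e''_def)
  have h1: "horner e q (Suc k) = y k" "horner e q (Suc (Suc k)) = q * y k - 1"
    by (simp_all only: y_def[symmetric] yS)
  have "horner e'' q (Suc k) = y k"
    unfolding y_def by (rule horner_cong) (simp add: e''_def)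
  then have h2: "horner e'' q (Suc (Suc (Suc k))) = q * (q * y k) - 1"
    by (simp add: e''_def) (simp add: e_def)
  \<comment> \<open>Small enough are, in turn, \<open>y k\<close>, then
    \<open>q * (q * y k) - 1\<close> with the digits 0, -1 appended, and \<open>q * y k - 1\<close>.
    What is left is \<open>q * y k = 1\<close>, the multinacci equation of order
    \<open>Suc k\<close>.\<close>
  consider "y k \<le> 1 / q\<^sup>2" | "y k > 1 / q\<^sup>2" "3 * q * y k < 2" | "3 * q * y k \<ge> 2" "q * y k \<noteq> 1" | "q * y k = 1"
    by linarith
  then show ?thesis
  proof cases
    case 1
    then have "\<bar>y k\<bar> \<le> max (1 / 3) (1 / q\<^sup>2)" using third by simp
    then show ?thesis using dig h1(1) third by (intro disjI1 exI[of _ e] exI[of _ "Suc k"]) auto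
  next
    case 2
    have "q * (q * y k) > 1" using 2 q_gt_1 by (simp add: field_simps power2_eq_square)
    moreover have "q * (q * y k) \<le> 2 * (q * y k)"
      using q2 third q_gt_1 by (intro mult_right_mono) auto
    ultimately show ?thesis using dig(2) h2 2
      by (intro disjI1 exI[of _ e''] exI[of _ "Suc (Suc (Suc k))"] conjI) (auto simp: le_max_iff_disj)
  next
    case 3
    then have "\<bar>q * y k - 1\<bar> \<le> 1 / 3" using k by linarith
    then show ?thesis using dig(1) h1(2) 3
      by (intro disjI1 exI[of _ e] exI[of _ "Suc (Suc k)"] conjI) (auto simp: le_max_iff_disj simp del: horner.simps)
  next
    case 4
    then have "y (Suc k) = 0" by (simp add: yS)
    then show ?thesis by (intro disjI2 exI[of _ "Suc k"]) (simp add: y_sum del: sum.lessThan_Suc power_Suc)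
  qed
qed

end

section \<open>Integrality of the base, and the sign argument\<close>

context loc_finite_base
begin

text \<open>An expansion of 1 has two equal remainders. As values of words with leading digit 1 they
  come from monic integer polynomials of different degrees, whose difference is monic and vanishes
  at \<open>q\<close>.\<close>

lemma algebraic_int_base:
  "algebraic_int q"
proof -
  obtain c :: "nat \<Rightarrow> int" where c: "\<forall>i. c i \<in> {0, 1}" "(\<lambda>i. of_int (c i) * geom i) sums 1"
    using digit_expansion[of 1] J_ge_1 by auto
  define e :: "nat \<Rightarrow> int" where "e i = 1" for i
  have ex: "expands c e 1" using c by (auto simp: expands_def e_def)
  define D where "D = (\<lambda>i. if i < 1 then e i else - c (i - 1))"
  have q0: "q \<noteq> 0" using q_gt_1 by simp
  have "horner D q (1 + n) \<in> digit_diffs q \<inter> {-J..J}" for n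
    using tail_state_in[OF ex, of n] tail_state_horner[OF q0, of c e 1 n] by (simp add: D_def)
  then have "finite (range (\<lambda>n. horner D q (1 + n)))"
    using fin[of J] by (rule_tac finite_subset) auto
  then obtain n k where nk: "n < k" "horner D q (1 + n) = horner D q (1 + k)"
    by (metis (no_types, lifting) finite_imageD infinite_UNIV_nat inj_onI linorder_neqE_nat)
  define P where "P n = (horner D [:0, 1:] (1 + n) :: real poly)" for n
  have P: "poly (P n) z = horner D z (1 + n)" for n z
    unfolding P_def by (induction n) (simp_all add: of_int_poly)
  have P_deg: "degree (P n) = n \<and> lead_coeff (P n) = 1 \<and> (\<forall>i. coeff (P n) i \<in> \<int>)" for n
  proof (induction n)
    case 0
    show ?case by (auto simp: P_def D_def e_def one_pCons coeff_pCons split: nat.splits)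
  next
    case (Suc n)
    have *: "P (Suc n) = pCons (of_int (D (Suc n))) (P n)"
      by (simp add: P_def of_int_poly)
    have "P n \<noteq> 0" using Suc by auto
    then show ?case using Suc by (auto simp: * coeff_pCons split: nat.splits)
  qed
  have dlt: "degree (P n) < degree (P k)" using P_deg nk by simp
  show ?thesis
  proof (rule algebraic_int.intros)
    have "degree (P k - P n) = k"
      using degree_add_eq_left[of "- P n" "P k"] dlt P_deg[of k] by simp
    moreover have "coeff (P k) k = 1" using P_deg[of k] by metis
    ultimately show "lead_coeff (P k - P n) = 1"
      using P_deg[of n] nk by (simp add: coeff_eq_0)
    show "\<forall>i. coeff (P k - P n) i \<in> \<int>" using P_deg by auto
    show "poly (P k - P n) q = 0" using nk P by simp
  qed
qed

end

lemma Re_of_int_mult: "Re (of_int k * z) = of_int k * Re z"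
  by simp

context loc_finite_base
begin

text \<open>The premise \<open>conv\<close> hides the question of convergence at \<open>w\<close>;
  replacing digits by 0 does not spoil their signs. The two opposite expansions force
  \<open>v = 0\<close> and then every term to vanish, so nonzero digits survive only where
  \<open>a i = 0\<close>. Such indices lie in \<open>N\<close>, where one expansion has digits at
  most 0 and the other at least 0; hence the common value is 0.\<close>

lemma sign_contradiction:
  fixes w \<gamma> :: complex
  defines "a \<equiv> \<lambda>i. Re (\<gamma> * (1 / w) ^ Suc i)"
  defines "N \<equiv> {i. a i \<le> 0}"
  assumes e: "\<forall>i. e i \<in> {-1, 0, 1}" and y0: "horner e q m \<noteq> 0"
    and le: "\<bar>horner e q m\<bar> \<le> weight N" "\<bar>horner e q m\<bar> \<le> weight (- N)"
    and conv: "\<And>d \<sigma>. expands d e m \<Longrightarrow> \<sigma> \<in> {1, -1 :: real} \<Longrightarrow> (\<And>i. 0 \<le> \<sigma> * (of_int (d i) * a i)) \<Longrightarrow>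
      \<exists>d'. (\<forall>i. d' i \<in> {0, d i}) \<and> expands d' e m \<and>
        (\<lambda>i. of_int (d' i) * (1 / w) ^ Suc i) sums horner e w m"
  shows False
proof -
  define v where "v = Re (\<gamma> * horner e w m)"
  have key: "\<exists>d'. (\<forall>i. d' i \<in> {0, d i}) \<and> (\<lambda>i. of_int (d' i) * geom i) sums horner e q m \<and>
      (\<lambda>i. of_int (d' i) * a i) sums v"
    if prem: "expands d e m" "\<sigma> \<in> {1, -1 :: real}" "\<And>i. 0 \<le> \<sigma> * (of_int (d i) * a i)" for d \<sigma>
  proof -
    obtain d' where d': "\<forall>i. d' i \<in> {0, d i}" "expands d' e m"
        and s: "(\<lambda>i. of_int (d' i) * (1 / w) ^ Suc i) sums horner e w m"
      using conv[OF prem] by blast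
    have "(\<lambda>i. Re (\<gamma> * (of_int (d' i) * (1 / w) ^ Suc i))) sums v"
      unfolding v_def by (intro sums_Re sums_mult s)
    moreover have "Re (\<gamma> * (of_int (d' i) * (1 / w) ^ Suc i)) = of_int (d' i) * a i" for i
      by (simp only: a_def mult.left_commute[of \<gamma>] Re_of_int_mult)
    ultimately show ?thesis using d' by (auto simp: expands_def)
  qed
  have a_sign: "i \<in> N \<Longrightarrow> a i \<le> 0" "i \<notin> N \<Longrightarrow> 0 \<le> a i" for i by (auto simp: N_def)
  obtain d :: "nat \<Rightarrow> int" where d: "\<forall>i \<in> N. d i \<in> {-1, 0}" "\<forall>i \<in> - N. d i \<in> {0, 1}"
      "(\<lambda>i. of_int (d i) * geom i) sums horner e q m"
    using signed_digit_expansion[of N "horner e q m"] le by (auto simp: abs_le_iff)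
  have d_pos: "0 \<le> 1 * (of_int (d i) * a i)" for i
    using d(1)[rule_format, of i] d(2)[rule_format, of i] a_sign[of i] by (cases "i \<in> N") auto
  have dd: "d i \<in> {-1, 0, 1}" for i using d(1,2) by (cases "i \<in> N") auto
  obtain d' where d': "\<forall>i. d' i \<in> {0, d i}" "(\<lambda>i. of_int (d' i) * geom i) sums horner e q m"
      "(\<lambda>i. of_int (d' i) * a i) sums v"
    using key[of d 1] d_pos dd e d(3) by (auto simp: expands_def)
  obtain c :: "nat \<Rightarrow> int" where c: "\<forall>i \<in> - N. c i \<in> {-1, 0}" "\<forall>i \<in> N. c i \<in> {0, 1}"
      "(\<lambda>i. of_int (c i) * geom i) sums horner e q m"
    using signed_digit_expansion[of "- N" "horner e q m"] le by (auto simp: abs_le_iff)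
  have c_pos: "0 \<le> -1 * (of_int (c i) * a i)" for i
    using c(1)[rule_format, of i] c(2)[rule_format, of i] a_sign[of i] by (cases "i \<in> N") auto
  have cc: "c i \<in> {-1, 0, 1}" for i using c(1,2) by (cases "i \<in> N") auto
  obtain c' where c': "\<forall>i. c' i \<in> {0, c i}" "(\<lambda>i. of_int (c' i) * geom i) sums horner e q m"
      "(\<lambda>i. of_int (c' i) * a i) sums v"
    using key[of c "-1"] c_pos cc e c(3) by (auto simp: expands_def)
  have d'_pos: "0 \<le> of_int (d' i) * a i" for i using d'(1)[rule_format, of i] d_pos[of i] by auto
  have c'_neg: "0 \<le> - (of_int (c' i) * a i)" for i using c'(1)[rule_format, of i] c_pos[of i] by auto
  have v0: "v = 0"
    using sums_le[OF _ sums_zero d'(3)] sums_le[OF _ sums_zero sums_minus[OF c'(3)]] d'_pos c'_neg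
    by force
  have "of_int (d' i) * a i = 0" for i
    using suminf_eq_zero_iff[of "\<lambda>i. of_int (d' i) * a i"] d'(3) d'_pos v0
    by (metis sums_summable sums_unique)
  moreover have "d i \<le> 0" if "a i = 0" for i using d(1)[rule_format, of i] that by (auto simp: N_def)
  ultimately have "of_int (d' i) \<le> (0 :: real)" for i
    using d'(1)[rule_format, of i] by (metis insertE mult_eq_0_iff of_int_0 of_int_le_0_iff order_refl singletonD)
  then have le0: "horner e q m \<le> 0"
    using sums_le[OF _ d'(2) sums_zero] geom_pos by (simp add: mult_nonpos_nonneg less_imp_le)
  have "- (of_int (c' i) * a i) = 0" for i
    using suminf_eq_zero_iff[of "\<lambda>i. - (of_int (c' i) * a i)"] sums_minus[OF c'(3)] c'_neg v0
    by (metis sums_summable sums_unique minus_zero)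
  moreover have "0 \<le> c i" if "a i = 0" for i using c(2)[rule_format, of i] that by (auto simp: N_def)
  ultimately have "(0 :: real) \<le> of_int (c' i)" for i
    using c'(1)[rule_format, of i]
    by (metis insertE mult_eq_0_iff neg_equal_0_iff_equal of_int_0 of_int_0_le_iff order_refl singletonD)
  then have "0 \<le> horner e q m"
    using sums_le[OF _ sums_zero c'(2)] geom_pos by (simp add: less_imp_le)
  with le0 y0 show False by simp
qed

text \<open>A run of \<open>K\<close> zero digits multiplies the remainder by \<open>q ^ K\<close>;
  but nonzero remainders have modulus at least \<open>\<mu>\<close>, and all have modulus at most
  \<open>J\<close>.\<close>

lemma expansion_gaps:
  assumes ex: "expands d e m"
  obtains (zero) n where "tail_state d e m n q = 0"
  | (gaps) K where "\<And>n. \<exists>i \<in> {n..<n + K}. d i \<noteq> 0"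
proof -
  define S where "S = digit_diffs q \<inter> {-J..J} - {0}"
  have finS: "finite S" using fin by (simp add: S_def)
  define \<mu> where "\<mu> = Min (insert 1 (abs ` S))"
  have \<mu>: "\<mu> > 0" unfolding \<mu>_def using finS by (subst Min_gr_iff) (auto simp: S_def)
  obtain K where K: "J / \<mu> < q ^ K" using real_arch_pow[OF q_gt_1] by blast
  show thesis
  proof (cases "\<exists>n. tail_state d e m n q = 0")
    case True
    then show ?thesis using zero by blast
  next
    case False
    have "\<exists>i \<in> {n..<n + K}. d i \<noteq> 0" for n
    proof (rule ccontr)
      assume neg: "\<not> ?thesis"
      have "k \<le> K \<Longrightarrow> tail_state d e m (n + k) q = q ^ k * tail_state d e m n q" for k
        using neg q_gt_1 by (induction k) (auto simp: tail_state_Suc)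
      then have eq: "tail_state d e m (n + K) q = q ^ K * tail_state d e m n q" by simp
      have "tail_state d e m n q \<in> S" using tail_state_in[OF ex] False by (simp add: S_def)
      then have "\<mu> \<le> \<bar>tail_state d e m n q\<bar>" unfolding \<mu>_def using finS by (intro Min_le) auto
      then have "q ^ K * \<mu> \<le> \<bar>q ^ K * tail_state d e m n q\<bar>"
        using q_gt_1 by (simp add: abs_mult mult_left_mono)
      moreover have "J < q ^ K * \<mu>" using K \<mu> by (simp add: field_simps)
      moreover have "\<bar>tail_state d e m (n + K) q\<bar> \<le> J"
        using tail_state_in[OF ex, of "n + K"] by (simp add: abs_le_iff)
      ultimately show False using eq by simp
    qed
    then show ?thesis using gaps by blast
  qed
qed

text \<open>On the unit circle the series at \<open>w\<close> need not converge. But its partial sums are bounded, so the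
  terms \<open>Re (\<gamma> w\<^sup>-\<^sup>i)\<close> with \<open>d\<^sub>i \<noteq> 0\<close> tend to \<open>0\<close>; if the gaps between nonzero digits are bounded, this
  makes a bounded power of \<open>w\<close> arbitrarily close to \<open>1\<close> without being equal to it. So the remainder
  vanishes at some point, where the expansion may be cut off.\<close>

lemma unit_circle_expansion:
  fixes w :: complex
  defines "\<gamma> \<equiv> \<i> * of_real (Im (1 / w)) * w\<^sup>2"
  assumes ex: "expands d e m" and w: "conj_pair q w" "norm w = 1" "Im w \<noteq> 0"
    and sg: "\<sigma> \<in> {1, -1 :: real}" and pos: "\<And>i. 0 \<le> \<sigma> * (of_int (d i) * Re (\<gamma> * (1 / w) ^ Suc i))"
  shows "\<exists>d'. (\<forall>i. d' i \<in> {0, d i}) \<and> expands d' e m \<and>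
        (\<lambda>i. of_int (d' i) * (1 / w) ^ Suc i) sums horner e w m"
  using ex
proof (cases rule: expansion_gaps)
  case (zero n)
  have q0: "q \<noteq> 0" and w0: "w \<noteq> 0" using q_gt_1 w by auto
  have "tail_state d e m n w = 0"
    using zero conj_pair_horner[OF w(1), of _ "m + n" "\<lambda>_. 0" 0] by (simp add: tail_state_horner q0 w0)
  then have w_fin: "horner e w m = (\<Sum>i<n. of_int (d i) * (1 / w) ^ Suc i)"
    using w0 by (simp add: tail_state_def)
  have q_fin: "horner e q m = (\<Sum>i<n. of_int (d i) * geom i)"
    using zero q0 by (simp add: tail_state_def geom_def)
  define d' where "d' i = (if i < n then d i else 0)" for i
  have fin_sums: "(\<lambda>i. of_int (d' i) * f i) sums (\<Sum>i<n. of_int (d i) * f i)" for f :: "nat \<Rightarrow> 'a::real_normed_field"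
    using sums_finite[of "{..<n}" "\<lambda>i. of_int (d' i) * f i"] by (simp add: d'_def)
  show ?thesis
    using fin_sums[of geom] fin_sums[of "\<lambda>i. (1 / w) ^ Suc i"] ex
    by (intro exI[of _ d']) (auto simp: expands_def q_fin w_fin d'_def)
next
  case (gaps K)
  have w0: "w \<noteq> 0" using w by auto
  define \<beta> where "\<beta> = 1 / w"
  have nb: "norm \<beta> = 1" using w by (simp add: \<beta>_def norm_divide)
  have Imb: "Im \<beta> \<noteq> 0" using w by (simp add: \<beta>_def Im_divide)
  define t where "t i = \<sigma> * (of_int (d i) * Re (\<gamma> * \<beta> ^ Suc i))" for i
  have t0: "0 \<le> t i" for i using pos by (simp add: t_def \<beta>_def)
  obtain C where C: "\<And>n. norm (tail_state d e m n w) \<le> C"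
    using tail_state_bounded[OF ex w(1)] by blast
  have "(\<Sum>i<n. t i) \<le> norm \<gamma> * (norm (horner e w m) + C)" for n
  proof -
    define u where "u = (\<Sum>i<n. of_int (d i) * \<beta> ^ Suc i)"
    have "norm (tail_state d e m n w) = norm (horner e w m - u)"
      using w by (simp add: tail_state_def u_def \<beta>_def norm_mult norm_power)
    then have "norm u \<le> norm (horner e w m) + C"
      using C[of n] norm_triangle_ineq2[of u "horner e w m"] norm_minus_commute[of u] by simp
    moreover have "(\<Sum>i<n. t i) = \<sigma> * Re (\<gamma> * u)"
      unfolding t_def u_def sum_distrib_left Re_sum
      by (intro sum.cong refl arg_cong[of _ _ "\<lambda>x. \<sigma> * x"])
        (simp only: mult.left_commute[of \<gamma>] Re_of_int_mult)
    moreover have "\<sigma> * Re (\<gamma> * u) \<le> norm (\<gamma> * u)"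
      using sg abs_Re_le_cmod[of "\<gamma> * u"] by auto
    ultimately show ?thesis
      by (smt (verit) mult_left_mono norm_ge_zero norm_mult)
  qed
  then have "summable t" using t0 by (intro summableI_nonneg_bounded) auto
  then have tend: "t \<longlonglongrightarrow> 0" by (rule summable_LIMSEQ_zero)
  \<comment> \<open>Here \<open>g\<close> is the distance between nonzero digits. Even powers are
    used because smallness of \<open>t i\<close> only puts
    \<open>\<beta> ^ Suc i * w\<^sup>2\<close> close to 1 or to -1.\<close>
  define \<eta> where "\<eta> = Min (insert 1 ((\<lambda>g. norm (\<beta> ^ (2 * g) - 1)) ` {1..K}))"
  have "\<beta> ^ (2 * g) \<noteq> 1" if "g \<ge> 1" for g
    using conj_pair_not_root_of_unity[OF w(1) q_gt_1, of "2 * g"] that by (simp add: \<beta>_def power_divide)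
  then have eta: "\<eta> > 0" unfolding \<eta>_def by (subst Min_gr_iff) auto
  have "\<forall>\<^sub>F i in sequentially. t i < \<eta> * \<bar>Im \<beta>\<bar> / 4"
    using eta Imb by (intro order_tendstoD(2)[OF tend]) simp
  then obtain n0 where n0: "\<And>i. i \<ge> n0 \<Longrightarrow> t i < \<eta> * \<bar>Im \<beta>\<bar> / 4"
    by (auto simp: eventually_sequentially)
  have close: "norm ((\<beta> ^ Suc i * w\<^sup>2)\<^sup>2 - 1) < \<eta> / 2" if i: "i \<ge> n0" "d i \<noteq> 0" for i
  proof -
    define v where "v = \<beta> ^ Suc i * w\<^sup>2"
    have "norm v = 1" using nb w by (simp add: v_def norm_mult norm_power)
    then have "v * cnj v = 1" using complex_norm_square[of v] by simp
    then have "v\<^sup>2 - 1 = v * (v - cnj v)" by (simp add: power2_eq_square algebra_simps)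
    then have nv: "norm (v\<^sup>2 - 1) = 2 * \<bar>Im v\<bar>"
      using \<open>norm v = 1\<close> by (simp add: norm_mult complex_diff_cnj)
    \<comment> \<open>\<open>\<gamma>\<close> is built so that each term is \<open>Im v\<close> up
      to a nonzero real factor; a small term thus puts the unit vector \<open>v\<close> near the
      real axis.\<close>
    have "\<gamma> * \<beta> ^ Suc i = \<i> * (of_real (Im \<beta>) * v)" by (simp add: \<gamma>_def v_def \<beta>_def mult_ac)
    then have "Re (\<gamma> * \<beta> ^ Suc i) = - (Im \<beta> * Im v)" by simp
    then have "t i = - \<sigma> * (of_int (d i) * (Im \<beta> * Im v))" by (simp add: t_def)
    moreover have "\<bar>of_int (d i) :: real\<bar> = 1"
      using ex i by (auto simp: expands_def dest!: spec[of _ i])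
    ultimately have "\<bar>t i\<bar> = \<bar>Im \<beta>\<bar> * \<bar>Im v\<bar>" using sg by (auto simp: abs_mult)
    then have "\<bar>Im \<beta>\<bar> * \<bar>Im v\<bar> < \<bar>Im \<beta>\<bar> * (\<eta> / 4)" using n0[OF i(1)] t0[of i] by (simp add: mult.commute)
    then have "\<bar>Im v\<bar> < \<eta> / 4" by (rule mult_left_less_imp_less) simp
    then show ?thesis using nv by (simp add: v_def)
  qed
  obtain i where i: "i \<ge> n0" "d i \<noteq> 0" using gaps[of n0] by auto
  obtain k where k: "k \<in> {Suc i..<Suc i + K}" "d k \<noteq> 0" using gaps[of "Suc i"] by auto
  define g where "g = k - i"
  have g: "g \<in> {1..K}" "k = i + g" using k by (auto simp: g_def)
  define v where "v = \<beta> ^ Suc i * w\<^sup>2"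
  have nv: "norm v = 1" using nb w by (simp add: v_def norm_mult norm_power)
  have "\<beta> ^ Suc k * w\<^sup>2 = v * \<beta> ^ g" by (simp add: v_def g(2) power_add mult_ac)
  then have 2: "norm ((v * \<beta> ^ g)\<^sup>2 - 1) < \<eta> / 2" using close[of k] k i by simp
  have 1: "norm (v\<^sup>2 - 1) < \<eta> / 2" using close[OF i] by (simp add: v_def)
  have "v\<^sup>2 * (\<beta> ^ (2 * g) - 1) = ((v * \<beta> ^ g)\<^sup>2 - 1) - (v\<^sup>2 - 1)"
    by (simp add: power_mult_distrib algebra_simps flip: power_mult)
  then have "norm (v\<^sup>2 * (\<beta> ^ (2 * g) - 1)) < \<eta>"
    using norm_triangle_ineq4[of "(v * \<beta> ^ g)\<^sup>2 - 1" "v\<^sup>2 - 1"] 1 2 by simp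
  then have "norm (\<beta> ^ (2 * g) - 1) < \<eta>" using nv by (simp add: norm_mult norm_power)
  moreover have "\<eta> \<le> norm (\<beta> ^ (2 * g) - 1)" unfolding \<eta>_def using g by (intro Min_le) auto
  ultimately show ?thesis by simp
qed

end

lemma rpoly_sum [simp]: "rpoly (sum f A) z = (\<Sum>i\<in>A. rpoly (f i) z)"
  by (induction A rule: infinite_finite_induct) simp_all

section \<open>Weights of the sign patterns\<close>

context base
begin

text \<open>As \<open>q \<le> 2\<close>, the two terms are at least \<open>1 / 4\<close> and
  \<open>1 / 8\<close>, which together exceed \<open>1 / 3\<close>; the first alone is
  \<open>1 / q\<^sup>2\<close>.\<close>

lemma weight_ge_one_two:
  assumes "{1, 2} \<subseteq> N"
  shows "max (1 / 3) (1 / q\<^sup>2) \<le> weight N"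
proof -
  have "geom 1 + geom 2 \<le> weight N" using sum_le_weight[of "{1, 2}" N] assms by simp
  moreover have "geom 1 + geom 2 = 1 / q\<^sup>2 + 1 / q ^ 3"
    by (simp add: geom_def power2_eq_square power3_eq_cube numeral_2_eq_2)
  moreover have "1 / q\<^sup>2 \<ge> 1 / 2\<^sup>2" "1 / q ^ 3 \<ge> 1 / 2 ^ 3"
    using q_gt_1 q_le_2 by (intro divide_left_mono power_mono mult_pos_pos; simp)+
  ultimately show ?thesis by simp
qed

text \<open>The weights of the odd indices form a geometric series with sum
  \<open>1 / (q\<^sup>2 - 1)\<close>.\<close>

lemma weight_ge_odd:
  assumes "{i. odd i} \<subseteq> N"
  shows "max (1 / 3) (1 / q\<^sup>2) \<le> weight N"
proof -
  define x where "x = 1 / q\<^sup>2"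
  have q2: "1 < q\<^sup>2" using q_gt_1 by simp
  have x: "0 < x" "x < 1" using q2 by (auto simp: x_def divide_less_eq)
  have "(\<Sum>k<n. x * x ^ k) \<le> weight N" for n
  proof -
    have "(\<Sum>k<n. x * x ^ k) = (\<Sum>k<n. geom (2 * k + 1))"
      by (intro sum.cong refl) (simp add: x_def geom_def power_mult power2_eq_square power_divide)
    also have "\<dots> = sum geom ((\<lambda>k. 2 * k + 1) ` {..<n})"
      by (subst sum.reindex) (auto simp: inj_on_def)
    also have "\<dots> \<le> weight N" using assms by (intro sum_le_weight) auto
    finally show ?thesis .
  qed
  moreover have "(\<lambda>k. x * x ^ k) sums (x * (1 / (1 - x)))" using x by (intro sums_mult geometric_sums) simp
  ultimately have "x * (1 / (1 - x)) \<le> weight N"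
    unfolding sums_def by (intro LIMSEQ_le_const2) auto
  moreover have "x * (1 / (1 - x)) = 1 / (q\<^sup>2 - 1)" using q2 q_gt_1 by (simp add: x_def field_simps)
  moreover have "q\<^sup>2 \<le> 2\<^sup>2" using q_gt_1 q_le_2 by (intro power_mono) auto
  then have "1 / 3 \<le> 1 / (q\<^sup>2 - 1)" using q2 by (intro divide_left_mono) auto
  moreover have "1 / q\<^sup>2 \<le> 1 / (q\<^sup>2 - 1)"
    using q2 by (intro divide_left_mono mult_pos_pos) auto
  ultimately show ?thesis by simp
qed

lemma weight_ge_zero:
  assumes "0 \<in> N"
  shows "max (1 / 3) (1 / q\<^sup>2) \<le> weight N"
proof -
  have "1 / q \<le> weight N" using sum_le_weight[of "{0}" N] assms by (simp add: geom_def)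
  moreover have "1 / 3 \<le> 1 / q" using q_gt_1 q_le_2 by (intro divide_left_mono) auto
  moreover have "q * 1 \<le> q * q" using q_gt_1 by (intro mult_left_mono) auto
  then have "1 / q\<^sup>2 \<le> 1 / q" using q_gt_1 by (intro divide_left_mono) (auto simp: power2_eq_square)
  ultimately show ?thesis by simp
qed

end

section \<open>Excluding conjugates outside the open unit disc\<close>

context loc_finite_base
begin

text \<open>The same digits 0, 1 expand the number 1 at \<open>q\<close> and at \<open>r\<close>. If
  \<open>r \<noteq> q\<close>, the powers in the two series differ always in the same direction, so
  all digits would be 0.\<close>

lemma positive_conj:
  assumes w: "conj_pair q (of_real r)" and r: "r > 1"
  shows "r = q"
proof (rule ccontr)
  assume ne: "r \<noteq> q"
  obtain c :: "nat \<Rightarrow> int" where c: "\<forall>i. c i \<in> {0, 1}" "(\<lambda>i. of_int (c i) * geom i) sums 1"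
    using digit_expansion[of 1] J_ge_1 by auto
  have ex: "expands c (\<lambda>_. 1) 1" using c by (auto simp: expands_def)
  have "(\<lambda>i. of_int (c i) * (1 / of_real r) ^ Suc i) sums (1 :: complex)"
    using expansion_conj_sums[OF ex w] r by simp
  moreover have "(1 / complex_of_real r) ^ Suc i = of_real ((1 / r) ^ Suc i)" for i by simp
  ultimately have "(\<lambda>i. of_int (c i) * complex_of_real ((1 / r) ^ Suc i)) sums 1" by (simp only:)
  from sums_Re[OF this] have "(\<lambda>i. of_int (c i) * (1 / r) ^ Suc i) sums 1"
    by (simp only: Re_of_int_mult Re_complex_of_real one_complex.sel)
  from sums_diff[OF c(2) this]
  have s: "(\<lambda>i. of_int (c i) * (geom i - (1 / r) ^ Suc i)) sums 0" by (simp add: right_diff_distrib)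
  obtain \<sigma> :: real where \<sigma>: "\<And>i. 0 < \<sigma> * (geom i - (1 / r) ^ Suc i)"
  proof (cases "r < q")
    case True
    then have "(1 / q) ^ Suc i < (1 / r) ^ Suc i" for i
      using r by (intro power_strict_mono divide_strict_left_mono) auto
    then show ?thesis using that[of "-1"] by (simp add: geom_def)
  next
    case False
    then have "(1 / r) ^ Suc i < (1 / q) ^ Suc i" for i
      using ne q_gt_1 by (intro power_strict_mono divide_strict_left_mono) auto
    then show ?thesis using that[of 1] by (simp add: geom_def)
  qed
  define t where "t i = of_int (c i) * (\<sigma> * (geom i - (1 / r) ^ Suc i))" for i
  have "t sums 0" using sums_mult[OF s, of \<sigma>] by (simp add: t_def[abs_def] mult.left_commute)
  moreover have "0 \<le> t i" for i using c(1)[rule_format, of i] \<sigma>[of i] by (auto simp: t_def)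
  ultimately have "t i = 0" for i
    using suminf_eq_zero_iff[of t] by (metis sums_summable sums_unique)
  then have "c i = 0" for i using \<sigma>[of i] by (metis t_def less_irrefl mult_eq_0_iff of_int_eq_0_iff)
  then show False using c(2) sums_unique2[OF sums_zero, of "1 :: real"] by simp
qed

lemma Pisot_if_loc_finite:
  assumes q2: "q < 2"
  shows "Pisot q"
  unfolding Pisot_iff
proof (intro conjI allI impI algebraic_int_base q_gt_1)
  fix w :: complex
  assume w: "conj_pair q w" and ne: "w \<noteq> of_real q"
  show "norm w < 1"
  proof (rule ccontr)
    assume "\<not> norm w < 1"
    then have n1: "norm w \<ge> 1" by simp
    then have w0: "w \<noteq> 0" by auto
    note nru = conj_pair_not_root_of_unity[OF w q_gt_1]
    have w1: "w \<noteq> 1" using nru[of 1] by simp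
    have no_multi: "q ^ n \<noteq> (\<Sum>i<n. q ^ i)" if "n > 0" for n
    proof
      assume eq: "q ^ n = (\<Sum>i<n. q ^ i)"
      then have "w ^ n = (\<Sum>i<n. w ^ i)"
        using conj_pair_eq_iff[OF w, of "[:0, 1:] ^ n" "\<Sum>i<n. [:0, 1:] ^ i"] by simp
      then show False using multinacci_conj[OF q_gt_1 that eq _ n1 w1] ne by blast
    qed
    then obtain e m where e: "\<forall>i. e i \<in> {-1, 0, 1}" "horner e q m \<noteq> 0"
        "\<bar>horner e q m\<bar> \<le> max (1 / 3) (1 / q\<^sup>2)"
      using small_digit_diff[OF q2] by blast
    \<comment> \<open>A real number on the unit circle would be 1 or -1, a root of unity.\<close>
    have *: "norm w > 1 \<or> Im w \<noteq> 0"
    proof (rule ccontr)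
      assume "\<not> ?thesis"
      then have "norm w = 1" "Im w = 0" using n1 by auto
      then have "w = 1 \<or> w = - 1" by (auto simp: complex_eq_iff cmod_def abs_if split: if_splits)
      then have "w ^ 2 = 1" by auto
      then show False using nru[of 2] by simp
    qed
    \<comment> \<open>Index 0 gets one sign, and the indices 1 and 2, or else all odd ones, get the
      other; then \<open>N\<close> and its complement are both heavy enough to expand the small
      value in both ways. A negative \<open>w\<close> yields alternating signs with
      \<open>\<gamma> = - 1\<close>.\<close>
    obtain \<gamma> where \<gamma>: "norm w > 1 \<or> \<gamma> = \<i> * of_real (Im (1 / w)) * w\<^sup>2 \<and> Im w \<noteq> 0"
      and N0: "Re (\<gamma> * (1 / w) ^ Suc 0) > 0"
      and N1: "{1, 2} \<subseteq> {i. Re (\<gamma> * (1 / w) ^ Suc i) \<le> 0} \<or> {i. odd i} \<subseteq> {i. Re (\<gamma> * (1 / w) ^ Suc i) \<le> 0}"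
    proof (cases "Im w = 0")
      case True
      define r where "r = Re w"
      have w_r: "w = of_real r" using True by (simp add: r_def complex_eq_iff)
      have "\<not> r > 1" using positive_conj w ne w_r by blast
      moreover have "\<bar>r\<bar> > 1" using True * w_r by auto
      ultimately have r: "r < 0" by auto
      have "(1 / w) ^ Suc i = of_real ((1 / r) ^ Suc i)" for i by (simp add: w_r)
      then have Re_eq: "Re (- 1 * (1 / w) ^ Suc i) = - ((1 / r) ^ Suc i)" for i
        by (simp only: mult_minus_left mult_1 uminus_complex.sel Re_complex_of_real)
      have "Re (- 1 * (1 / w) ^ Suc i) \<le> 0" if "odd i" for i
        unfolding Re_eq using that by (simp add: zero_le_even_power del: power_Suc)
      moreover have "Re (- 1 * (1 / w) ^ Suc 0) > 0" unfolding Re_eq using r by simp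
      ultimately show ?thesis using that[of "- 1"] True * by blast
    next
      case False
      \<comment> \<open>up to a positive factor, \<open>Re (\<gamma> z)\<close> is the real-linear form that vanishes at \<open>w\<^sup>-\<^sup>2\<close> and is
        positive at \<open>w\<^sup>-\<^sup>1\<close>, hence negative at \<open>w\<^sup>-\<^sup>3\<close>\<close>
      define \<gamma> where "\<gamma> = \<i> * of_real (Im (1 / w)) * w\<^sup>2"
      have 0: "\<gamma> * (1 / w) ^ Suc 0 = \<i> * (of_real (Im (1 / w)) * w)"
        using w0 by (simp add: \<gamma>_def power2_eq_square)
      have 1: "\<gamma> * (1 / w) ^ Suc 1 = \<i> * of_real (Im (1 / w))"
        using w0 by (simp add: \<gamma>_def power2_eq_square)
      have 2: "\<gamma> * (1 / w) ^ Suc 2 = \<i> * (of_real (Im (1 / w)) * (1 / w))"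
        using w0 by (simp add: \<gamma>_def power2_eq_square numeral_2_eq_2)
      have "Re (\<gamma> * (1 / w) ^ Suc 0) = - (Im (1 / w) * Im w)" unfolding 0 by simp
      also have "\<dots> = (Im w)\<^sup>2 / (norm w)\<^sup>2"
        by (simp add: Im_divide power2_eq_square cmod_def)
      also have "\<dots> > 0" using False w0 by simp
      finally have "Re (\<gamma> * (1 / w) ^ Suc 0) > 0" .
      moreover have "Re (\<gamma> * (1 / w) ^ Suc 1) \<le> 0" unfolding 1 by simp
      moreover have "Re (\<gamma> * (1 / w) ^ Suc 2) = - (Im (1 / w) * Im (1 / w))"
        unfolding 2 by (simp only: Re_i_times times_complex.sel Re_complex_of_real Im_complex_of_real
            imaginary_unit.sel mult_zero_left add_0_right mult_1_left diff_0)
      then have "Re (\<gamma> * (1 / w) ^ Suc 2) \<le> 0" by simp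
      ultimately show ?thesis using that[of \<gamma>] False by (simp add: \<gamma>_def del: power_Suc)
    qed
    define N where "N = {i. Re (\<gamma> * (1 / w) ^ Suc i) \<le> 0}"
    have wN: "max (1 / 3) (1 / q\<^sup>2) \<le> weight N"
      using N1 weight_ge_one_two weight_ge_odd unfolding N_def by blast
    have "0 \<in> - N" using N0 by (simp add: N_def)
    then have wN': "max (1 / 3) (1 / q\<^sup>2) \<le> weight (- N)" by (rule weight_ge_zero)
    show False
    proof (rule sign_contradiction[of e m \<gamma> w])
      fix d and \<sigma> :: real
      assume d: "expands d e m" "\<sigma> \<in> {1, -1}"
        "\<And>i. 0 \<le> \<sigma> * (of_int (d i) * Re (\<gamma> * (1 / w) ^ Suc i))"
      show "\<exists>d'. (\<forall>i. d' i \<in> {0, d i}) \<and> expands d' e m \<and>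
          (\<lambda>i. of_int (d' i) * (1 / w) ^ Suc i) sums horner e w m"
      proof (cases "norm w > 1")
        case True
        show ?thesis using expansion_conj_sums[OF d(1) w True] d(1) by (intro exI[of _ d]) simp
      next
        case False
        then have "norm w = 1" "Im w \<noteq> 0" and g: "\<gamma> = \<i> * of_real (Im (1 / w)) * w\<^sup>2"
          using n1 \<gamma> by auto
        then show ?thesis using unit_circle_expansion[OF d(1) w _ _ d(2)] d(3) unfolding g by blast
      qed
    qed (use e wN wN' in \<open>auto simp: N_def\<close>)
  qed
qed

end

section \<open>Gaps of the spectrum\<close>

context base
begin

definition small_diffs :: bool where
  "small_diffs \<longleftrightarrow> (\<forall>\<epsilon> > 0. \<exists>y \<in> digit_diffs q. y \<noteq> 0 \<and> \<bar>y\<bar> < \<epsilon>)"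

lemma small_diffsE:
  assumes small_diffs "\<epsilon> > 0"
  obtains n a b where "a \<in> digit_sums q n" "b \<in> digit_sums q n" "0 < b - a" "b - a < \<epsilon>"
proof -
  obtain y where y: "y \<in> digit_diffs q" "y \<noteq> 0" "\<bar>y\<bar> < \<epsilon>" using assms by (auto simp: small_diffs_def)
  then obtain n a b where "a \<in> digit_sums q n" "b \<in> digit_sums q n" "y = b - a"
    by (auto simp: digit_diffs_def)
  then show thesis using y that[of a n b] that[of b n a] by (cases "y > 0") auto
qed

text \<open>A tiny difference \<open>b - a\<close>, scaled by a power of \<open>q\<close>, lands in
  \<open>[\<epsilon> / q, \<epsilon>)\<close> and lengthens the chain by one step; the words of
  \<open>a\<close> and \<open>b\<close> become prefixes to the earlier chain.\<close>

lemma digit_sums_chain: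
  assumes sd: small_diffs and eps: "\<epsilon> > 0"
  shows "\<exists>n f. (\<forall>i\<le>j. f i \<in> digit_sums q n) \<and> (\<forall>i<j. \<epsilon> / q \<le> f (Suc i) - f i \<and> f (Suc i) - f i < \<epsilon>)"
proof (induction j)
  case 0
  show ?case by (intro exI[of _ 0] exI[of _ "\<lambda>_. 0"]) simp
next
  case (Suc j)
  then obtain n f where f: "\<And>i. i \<le> j \<Longrightarrow> f i \<in> digit_sums q n"
      "\<And>i. i < j \<Longrightarrow> \<epsilon> / q \<le> f (Suc i) - f i \<and> f (Suc i) - f i < \<epsilon>"
    by blast
  \<comment> \<open>The difference is taken so small that the scaling needs more than
    \<open>n\<close> places, which leaves room for the words of the earlier chain behind the
    prefix.\<close>
  have "\<epsilon> / q ^ Suc n > 0" using eps q_gt_1 by simp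
  then obtain N a b where ab: "a \<in> digit_sums q N" "b \<in> digit_sums q N" "0 < b - a" "b - a < \<epsilon> / q ^ Suc n"
    using small_diffsE[OF sd] by blast
  obtain K where "\<epsilon> / (b - a) < q ^ K" using real_arch_pow[OF q_gt_1] by blast
  then have "\<epsilon> \<le> q ^ K * (b - a)" using ab by (simp add: field_simps)
  then have ex: "\<exists>K. \<epsilon> \<le> q ^ K * (b - a)" by blast
  define K0 where "K0 = (LEAST K. \<epsilon> \<le> q ^ K * (b - a))"
  have K0: "\<epsilon> \<le> q ^ K0 * (b - a)" unfolding K0_def using ex by (rule LeastI_ex)
  have nK: "Suc n < K0"
  proof (rule ccontr)
    assume "\<not> Suc n < K0"
    then have "q ^ K0 \<le> q ^ Suc n" using q_gt_1 by (intro power_increasing) auto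
    then have "q ^ K0 * (b - a) \<le> q ^ Suc n * (b - a)" using ab by (intro mult_right_mono) auto
    moreover have "q ^ Suc n * (b - a) < \<epsilon>" using ab(4) q_gt_1 by (simp add: field_simps del: power_Suc)
    ultimately show False using K0 by simp
  qed
  then obtain k where k: "K0 = Suc k" by (cases K0) auto
  have lt: "q ^ k * (b - a) < \<epsilon>"
    using not_less_Least[of k "\<lambda>K. \<epsilon> \<le> q ^ K * (b - a)"] k K0_def by simp
  have ge: "\<epsilon> / q \<le> q ^ k * (b - a)" using K0 q_gt_1 by (simp add: k field_simps)
  have fk: "f i \<in> digit_sums q k" if "i \<le> j" for i
    using f(1)[OF that] digit_sums_mono[of n k q] nK k by auto
  define g where "g i = (if i \<le> j then q ^ k * a + f i else q ^ k * b + f j)" for i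
  have "g i \<in> digit_sums q (N + k)" if "i \<le> Suc j" for i
    using digit_sums_append ab fk by (simp add: g_def)
  moreover have "\<epsilon> / q \<le> g (Suc i) - g i \<and> g (Suc i) - g i < \<epsilon>" if "i < Suc j" for i
  proof (cases "i = j")
    case True
    then have "g (Suc i) - g i = q ^ k * (b - a)" by (simp add: g_def right_diff_distrib)
    then show ?thesis using lt ge by simp
  next
    case False
    then show ?thesis using f(2)[of i] that by (simp add: g_def)
  qed
  ultimately show ?case by blast
qed

text \<open>A chain of small steps longer than the gaps of the scaled copy fills these gaps.\<close>

lemma digit_sums_sum_dense:
  assumes sd: small_diffs and eps: "\<epsilon> > 0" and c: "c > 0"
  shows "\<exists>B. \<forall>t \<ge> B. \<exists>n. \<exists>u \<in> digit_sums q n. \<exists>v \<in> digit_sums q n. t < u + c * v \<and> u + c * v \<le> t + \<epsilon>"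
proof -
  \<comment> \<open>With \<open>j\<close> steps of at least \<open>\<epsilon> / q\<close> the chain
    spans more than \<open>c\<close>, which bounds the gaps between the scaled values
    \<open>c * v\<close>.\<close>
  obtain j :: nat where "c * q / \<epsilon> < real j" using reals_Archimedean2 by blast
  then have j: "c < real j * (\<epsilon> / q)" using eps q_gt_1 by (simp add: field_simps)
  obtain n f where f: "\<And>i. i \<le> j \<Longrightarrow> f i \<in> digit_sums q n"
      "\<And>i. i < j \<Longrightarrow> \<epsilon> / q \<le> f (Suc i) - f i \<and> f (Suc i) - f i < \<epsilon>"
    using digit_sums_chain[OF sd eps, of j] by blast
  have "real i * (\<epsilon> / q) \<le> f i - f 0" if "i \<le> j" for i
    using that
  proof (induction i)
    case (Suc i)
    moreover have "real (Suc i) * (\<epsilon> / q) = real i * (\<epsilon> / q) + \<epsilon> / q"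
      by (simp only: of_nat_Suc distrib_right mult_1)
    ultimately show ?case using f(2)[of i] by simp
  qed simp
  then have span: "c < f j - f 0" using j by force
  have "\<exists>n. \<exists>u \<in> digit_sums q n. \<exists>v \<in> digit_sums q n. t < u + c * v \<and> u + c * v \<le> t + \<epsilon>"
    if t: "t \<ge> f 0" for t
  proof -
    define \<tau> where "\<tau> = (t - f 0) / c"
    have \<tau>0: "0 \<le> \<tau>" using t c by (simp add: \<tau>_def)
    have J0: "J > 0" using J_ge_1 by simp
    obtain N where "\<tau> / J + 1 < q ^ N" using real_arch_pow[OF q_gt_1] by blast
    then have "\<tau> < (q ^ N - 1) * J" using J0 by (simp add: field_simps)
    then obtain v b where v: "v \<in> digit_sums q N" "v \<le> \<tau>" "\<tau> < b" "b \<le> v + 1"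
      using digit_sums_neighbours[OF \<tau>0] by blast
    have "c * v \<le> t - f 0" "t - f 0 < c * b"
      using v c by (auto simp: \<tau>_def field_simps)
    moreover have "c * b \<le> c * (v + 1)" using v c by (intro mult_left_mono) auto
    ultimately have "c * v \<le> t - f 0" "t - f 0 < c * v + c" by (simp_all add: distrib_left)
    then have lo: "c * v + f 0 \<le> t" and hi: "t < c * v + f j" using span by auto
    \<comment> \<open>The first chain element beyond \<open>t\<close>; it is not \<open>f 0\<close>
      by \<open>lo\<close>, so its predecessor bounds the overshoot by
      \<open>\<epsilon>\<close>.\<close>
    define i where "i = (LEAST i. t < c * v + f i)"
    have i: "t < c * v + f i" unfolding i_def using hi by (rule LeastI)
    have ij: "i \<le> j" unfolding i_def using hi by (rule Least_le)
    obtain i' where i': "i = Suc i'" using i lo by (cases i) auto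
    have "c * v + f i' \<le> t"
      using not_less_Least[of i' "\<lambda>i. t < c * v + f i"] i' i_def by simp
    then have "f i + c * v \<le> t + \<epsilon>" using f(2)[of i'] i' ij by simp
    moreover have "f i \<in> digit_sums q (max n N)" "v \<in> digit_sums q (max n N)"
      using f(1)[OF ij] v(1) digit_sums_mono[of n "max n N" q] digit_sums_mono[of N "max n N" q] by auto
    ultimately show ?thesis using i by (auto simp: add.commute)
  qed
  then show ?thesis by blast
qed

end

section \<open>Digit sums inside the spectrum\<close>

lemma sum_in_spectrum:
  assumes "\<And>i. s i \<le> m"
  shows "(\<Sum>i<n. real (s i) * q ^ i) \<in> spectrum m q"
proof -
  have "(\<Sum>i<n. real (s i) * q ^ i) = (\<Sum>i\<le>n. real (if i < n then s i else 0) * q ^ i)"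
    by (intro sum.mono_neutral_cong_left) auto
  then show ?thesis using assms
    unfolding spectrum_def mem_Collect_eq
    by (intro exI[of _ n] exI[of _ "\<lambda>i. if i < n then s i else 0"]) auto
qed

text \<open>Passes from \<open>horner\<close>, with the leading digit first, to the convention of
  \<open>spectrum\<close>, where digit \<open>i\<close> belongs to \<open>q ^ i\<close>.\<close>

lemma digit_sums_sum:
  assumes "x \<in> digit_sums q n"
  shows "\<exists>s. (\<forall>i. s i \<le> 1) \<and> x = (\<Sum>i<n. real (s i) * q ^ i)"
  using assms
proof (induction n arbitrary: x)
  case (Suc n)
  then obtain y and d :: nat where y: "y \<in> digit_sums q n" "d \<le> 1" "x = q * y + real d"
    by (metis digit_sums_Suc add.right_neutral of_nat_0 of_nat_1 order_refl zero_le)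
  then obtain s where s: "\<forall>i. s i \<le> 1" "y = (\<Sum>i<n. real (s i) * q ^ i)" using Suc.IH by blast
  define s' where "s' i = (case i of 0 \<Rightarrow> d | Suc i \<Rightarrow> s i)" for i
  have "x = (\<Sum>i<Suc n. real (s' i) * q ^ i)"
    by (simp add: sum.lessThan_Suc_shift s'_def s(2) y(3) sum_distrib_left mult_ac del: sum.lessThan_Suc)
  moreover have "\<forall>i. s' i \<le> 1" using s y by (auto simp: s'_def split: nat.splits)
  ultimately show ?case by blast
qed (auto intro: exI[of _ "\<lambda>_. 0"])

lemma digit_sums_add_in_spectrum:
  assumes "x \<in> digit_sums q n" "y \<in> digit_sums q n" "m \<ge> 2"
  shows "x + y \<in> spectrum m q"
proof -
  obtain s t where s: "\<forall>i. s i \<le> 1" "x = (\<Sum>i<n. real (s i) * q ^ i)"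
      and t: "\<forall>i. t i \<le> 1" "y = (\<Sum>i<n. real (t i) * q ^ i)"
    using assms digit_sums_sum by meson
  have "x + y = (\<Sum>i<n. real (s i + t i) * q ^ i)"
    by (simp add: s t sum.distrib distrib_right)
  moreover have "s i + t i \<le> m" for i using s(1)[rule_format, of i] t(1)[rule_format, of i] assms(3) by simp
  ultimately show ?thesis using sum_in_spectrum by metis
qed

lemma digit_sums_in_spectrum:
  assumes "x \<in> digit_sums q n" "m \<ge> 1"
  shows "x \<in> spectrum m q"
proof -
  obtain s where s: "\<forall>i. s i \<le> 1" "x = (\<Sum>i<n. real (s i) * q ^ i)"
    using assms digit_sums_sum by blast
  then have "s i \<le> m" for i using assms(2) order_trans by blast
  then show ?thesis unfolding s(2) by (rule sum_in_spectrum)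
qed

text \<open>\<open>x\<close> occupies the exponents divisible by \<open>k\<close> and
  \<open>q * y\<close> those congruent to 1; as \<open>k \<ge> 2\<close> they never meet, so no
  digit exceeds 1.\<close>

lemma digit_sums_interleave_in_spectrum:
  assumes x: "x \<in> digit_sums (q ^ k) n" and y: "y \<in> digit_sums (q ^ k) n" and k: "k \<ge> 2" and m: "m \<ge> 1"
  shows "x + q * y \<in> spectrum m q"
proof -
  obtain s t where s: "\<forall>i. s i \<le> 1" "x = (\<Sum>i<n. real (s i) * (q ^ k) ^ i)"
      and t: "\<forall>i. t i \<le> 1" "y = (\<Sum>i<n. real (t i) * (q ^ k) ^ i)"
    using x y digit_sums_sum by meson
  have 0: "inj_on (\<lambda>i. k * i) {..<n}" "inj_on (\<lambda>i. k * i + 1) {..<n}"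
    using k by (auto simp: inj_on_def)
  define A B where "A = (\<lambda>i. k * i) ` {..<n}" and "B = (\<lambda>i. k * i + 1) ` {..<n}"
  have modA: "i mod k = 0" if "i \<in> A" for i using that by (auto simp: A_def)
  have "(k * i + 1) mod k = 1" for i using k mod_mult_self4[of k i 1] by simp
  then have modB: "i mod k = 1" if "i \<in> B" for i using that by (auto simp: B_def)
  have disj: "A \<inter> B = {}" using modA modB by fastforce
  define r where "r i = (if i \<in> A then s (i div k) else if i \<in> B then t (i div k) else 0)" for i
  have ABsub: "A \<union> B \<subseteq> {..<k * n + 2}"
  proof
    fix j assume "j \<in> A \<union> B"
    then obtain i where i: "i < n" "j = k * i \<or> j = k * i + 1" by (auto simp: A_def B_def)
    have "k * i \<le> k * n" using i(1) by simp
    with i(2) have "j \<le> k * n + 1" by linarith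
    then show "j \<in> {..<k * n + 2}" by simp
  qed
  have "(\<Sum>i<k * n + 2. real (r i) * q ^ i) = (\<Sum>i\<in>A \<union> B. real (r i) * q ^ i)"
    using ABsub by (intro sum.mono_neutral_right) (auto simp: r_def)
  also have "\<dots> = (\<Sum>i\<in>A. real (r i) * q ^ i) + (\<Sum>i\<in>B. real (r i) * q ^ i)"
    using disj by (intro sum.union_disjoint) (auto simp: A_def B_def)
  also have "(\<Sum>i\<in>A. real (r i) * q ^ i) = (\<Sum>i<n. real (r (k * i)) * q ^ (k * i))"
    unfolding A_def by (simp add: sum.reindex[OF 0(1)])
  also have "\<dots> = x"
    unfolding s(2) using k by (intro sum.cong) (auto simp: r_def A_def power_mult)
  also have "(\<Sum>i\<in>B. real (r i) * q ^ i) = (\<Sum>i<n. real (r (k * i + 1)) * q ^ (k * i + 1))"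
    unfolding B_def sum.reindex[OF 0(2)] o_def ..
  also have "\<dots> = (\<Sum>i<n. q * (real (t i) * (q ^ k) ^ i))"
  proof (intro sum.cong refl)
    fix i assume "i \<in> {..<n}"
    then have "k * i + 1 \<in> B" by (auto simp: B_def)
    moreover have "k * i + 1 \<notin> A" using calculation disj by blast
    moreover have "(k * i + 1) div k = i" using k by (intro div_nat_eqI) auto
    ultimately show "real (r (k * i + 1)) * q ^ (k * i + 1) = q * (real (t i) * (q ^ k) ^ i)"
      by (simp add: r_def power_mult power_add)
  qed
  also have "\<dots> = q * y" by (simp add: t(2) sum_distrib_left)
  finally have "x + q * y = (\<Sum>i<k * n + 2. real (r i) * q ^ i)" by simp
  moreover have "r i \<le> m" for i
    using s(1)[rule_format, of "i div k"] t(1)[rule_format, of "i div k"] m by (simp add: r_def)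
  ultimately show ?thesis using sum_in_spectrum by metis
qed

section \<open>From close or dense points of the spectrum to vanishing gaps\<close>

lemma upper_gap_eq_0:
  assumes q: "q > 1" and m: "m > 0"
    and dense: "\<And>\<epsilon>. \<epsilon> > 0 \<Longrightarrow> \<exists>B. \<forall>t \<ge> B. \<exists>z \<in> spectrum m q. t < z \<and> z \<le> t + \<epsilon>"
  shows "upper_gap m q = 0"
proof -
  let ?x = "spectrum_seq m q"
  have mono: "strict_mono ?x" and range: "range ?x = spectrum m q" using spectrum_seq[OF q m] by auto
  have unb: "\<exists>k0. \<forall>k \<ge> k0. B \<le> ?x k" for B
  proof -
    obtain N where N: "B < q ^ N" using real_arch_pow[OF q] by blast
    have "(\<Sum>i<Suc N. real (if i = N then 1 else 0) * q ^ i) \<in> spectrum m q"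
      using m by (intro sum_in_spectrum) auto
    then have "q ^ N \<in> range ?x" by (simp add: range)
    then obtain k0 where k0: "?x k0 = q ^ N" by auto
    have "B \<le> ?x k" if "k \<ge> k0" for k
      using strict_mono_mono[OF mono] that N k0 by (metis less_imp_le monoD order_trans)
    then show ?thesis by blast
  qed
  have *: "limsup (\<lambda>k. ereal (?x (Suc k) - ?x k)) \<le> ereal \<epsilon>" if e: "\<epsilon> > 0" for \<epsilon>
  proof (rule Limsup_bounded)
    obtain B where B: "\<And>t. t \<ge> B \<Longrightarrow> \<exists>z \<in> spectrum m q. t < z \<and> z \<le> t + \<epsilon>" using dense[OF e] by blast
    obtain k0 where k0: "\<And>k. k \<ge> k0 \<Longrightarrow> B \<le> ?x k" using unb by blast
    have "?x (Suc k) - ?x k \<le> \<epsilon>" if k: "k \<ge> k0" for k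
    proof -
      obtain z where z: "z \<in> range ?x" "?x k < z" "z \<le> ?x k + \<epsilon>" using B[OF k0[OF k]] range by blast
      then obtain l where l: "z = ?x l" by blast
      then have "k < l" using z mono by (simp add: strict_mono_less)
      then have "?x (Suc k) \<le> ?x l" using mono by (simp add: strict_mono_less_eq)
      then show ?thesis using z l by simp
    qed
    then show "\<forall>\<^sub>F k in sequentially. ereal (?x (Suc k) - ?x k) \<le> ereal \<epsilon>"
      by (auto simp: eventually_sequentially)
  qed
  have "upper_gap m q \<le> 0"
  proof (rule ereal_le_epsilon2)
    fix e :: real assume "0 < e"
    from *[OF this] show "upper_gap m q \<le> 0 + ereal e" by (simp only: upper_gap_def add_0)
  qed
  have "0 \<le> ereal (?x (Suc k) - ?x k)" for k
    using strict_monoD[OF mono, of k "Suc k"] by simp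
  then have "0 \<le> upper_gap m q"
    unfolding upper_gap_def
    by (intro le_Limsup always_eventually allI) (simp_all only: trivial_limit_sequentially not_False_eq_True)
  with \<open>upper_gap m q \<le> 0\<close> show ?thesis by (rule antisym)
qed

lemma lower_gap_eq_0:
  assumes q: "q > 1" and m: "m > 0"
    and close: "\<And>\<epsilon> B. \<epsilon> > 0 \<Longrightarrow> \<exists>a \<in> spectrum m q. \<exists>b \<in> spectrum m q. B < a \<and> a < b \<and> b < a + \<epsilon>"
  shows "lower_gap m q = 0"
proof -
  let ?x = "spectrum_seq m q"
  have mono: "strict_mono ?x" and range: "range ?x = spectrum m q" using spectrum_seq[OF q m] by auto
  have *: "liminf (\<lambda>k. ereal (?x (Suc k) - ?x k)) \<le> ereal \<epsilon>" if e: "\<epsilon> > 0" for \<epsilon>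
  proof (rule ccontr)
    assume "\<not> ?thesis"
    then have "\<forall>\<^sub>F k in sequentially. ereal \<epsilon> < ereal (?x (Suc k) - ?x k)"
      by (intro less_LiminfD) simp
    then obtain k0 where k0: "\<And>k. k \<ge> k0 \<Longrightarrow> \<epsilon> < ?x (Suc k) - ?x k"
      by (auto simp: eventually_sequentially)
    obtain a b where ab: "a \<in> range ?x" "b \<in> range ?x" "?x k0 < a" "a < b" "b < a + \<epsilon>"
      using close[OF e, of "?x k0"] range by blast
    then obtain k l where kl: "a = ?x k" "b = ?x l" by blast
    then have "k0 < k" "k < l" using ab mono by (simp_all add: strict_mono_less)
    then have "?x (Suc k) \<le> ?x l" using mono by (simp add: strict_mono_less_eq)
    then show False using k0[of k] \<open>k0 < k\<close> ab kl by simp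
  qed
  have "lower_gap m q \<le> 0"
  proof (rule ereal_le_epsilon2)
    fix e :: real assume "0 < e"
    from *[OF this] show "lower_gap m q \<le> 0 + ereal e" by (simp only: lower_gap_def add_0)
  qed
  have "0 \<le> ereal (?x (Suc k) - ?x k)" for k
    using strict_monoD[OF mono, of k "Suc k"] by simp
  then have "0 \<le> lower_gap m q"
    unfolding lower_gap_def
    by (intro Liminf_bounded always_eventually allI)
  with \<open>lower_gap m q \<le> 0\<close> show ?thesis by (rule antisym)
qed

context base
begin

lemma upper_gap_eq_0_of_small_diffs:
  assumes small_diffs "m \<ge> 2"
  shows "upper_gap m q = 0"
proof (rule upper_gap_eq_0[OF q_gt_1])
  fix \<epsilon> :: real assume "\<epsilon> > 0"
  from digit_sums_sum_dense[OF assms(1) this, of 1]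
  show "\<exists>B. \<forall>t \<ge> B. \<exists>z \<in> spectrum m q. t < z \<and> z \<le> t + \<epsilon>"
    using digit_sums_add_in_spectrum[OF _ _ assms(2)] by (metis mult_1 zero_less_one)
qed (use assms in simp)

lemma lower_gap_eq_0_of_small_diffs:
  assumes sd: small_diffs and m: "m \<ge> 1"
  shows "lower_gap m q = 0"
proof (rule lower_gap_eq_0[OF q_gt_1])
  fix \<epsilon> B :: real assume "\<epsilon> > 0"
  then obtain n a b where ab: "a \<in> digit_sums q n" "b \<in> digit_sums q n" "0 < b - a" "b - a < \<epsilon>"
    using small_diffsE[OF sd] by blast
  obtain N where N: "B < q ^ N" using real_arch_pow[OF q_gt_1] by blast
  have one: "1 \<in> digit_sums q (Suc N)" for N by (auto simp: digit_sums_Suc intro: bexI[of _ 0])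
  \<comment> \<open>The prefix 1, placed high enough, moves the close pair beyond \<open>B\<close>
    without changing its difference.\<close>
  have mem: "q ^ (n + N) + x \<in> spectrum m q" if "x \<in> digit_sums q n" for x
  proof -
    have "x \<in> digit_sums q (n + N)" using that digit_sums_mono[of n "n + N" q] by auto
    then show ?thesis
      using digit_sums_append[OF one[of 0], of x "n + N"] digit_sums_in_spectrum[OF _ m] by simp
  qed
  have "q ^ N \<le> q ^ (n + N)" using q_gt_1 by (intro power_increasing) auto
  then have "B < q ^ (n + N) + a" using N digit_sums_nonneg[OF ab(1)] by simp
  then show "\<exists>a \<in> spectrum m q. \<exists>b \<in> spectrum m q. B < a \<and> a < b \<and> b < a + \<epsilon>"
    using mem[OF ab(1)] mem[OF ab(2)] ab
    by (intro bexI[of _ "q ^ (n + N) + a"] bexI[of _ "q ^ (n + N) + b"]) auto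
qed (use m in simp)

end

text \<open>Density is applied in base \<open>q ^ k\<close> with \<open>c = q\<close>, so that the
  interleaved sums \<open>u + q * v\<close> arise.\<close>

lemma upper_gap_eq_0_of_small_diffs_power:
  assumes q: "q > 1" and b: "base (q ^ k)" and sd: "base.small_diffs (q ^ k)" and k: "k \<ge> 2" and m: "m \<ge> 1"
  shows "upper_gap m q = 0"
proof (rule upper_gap_eq_0[OF q])
  fix \<epsilon> :: real assume "\<epsilon> > 0"
  from base.digit_sums_sum_dense[OF b sd this, of q]
  show "\<exists>B. \<forall>t \<ge> B. \<exists>z \<in> spectrum m q. t < z \<and> z \<le> t + \<epsilon>"
    using digit_sums_interleave_in_spectrum[OF _ _ k m] q by (metis less_trans zero_less_one)
qed (use m in simp)

lemma (in base) small_diffs_if_not_Pisot: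
  assumes "q < 2" "\<not> Pisot q"
  shows small_diffs
proof (rule ccontr)
  assume "\<not> small_diffs"
  then obtain \<mu> where \<mu>: "\<mu> > 0" "\<And>y. y \<in> digit_diffs q \<Longrightarrow> y \<noteq> 0 \<Longrightarrow> \<mu> \<le> \<bar>y\<bar>"
    unfolding small_diffs_def by (meson not_le)
  then have "finite (digit_diffs q \<inter> {-1..1})"
    using finite_digit_diffs_unit[OF assms(1)] by blast
  then have "finite (digit_diffs q \<inter> {-R..R})" for R by (rule finite_digit_diffs_bounded)
  then interpret loc_finite_base q by unfold_locales
  show False using Pisot_if_loc_finite assms by blast
qed

theorem theorem1p4:
  fixes q :: real
  assumes "1 < q" and "q < 2" and "\<not> Pisot q"
  shows "(1 < q \<and> q \<le> root 3 2 \<longrightarrow> upper_gap 1 q = 0) \<and>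
         (1 < q \<and> q \<le> sqrt 2 \<longrightarrow> lower_gap 1 q = 0 \<and> upper_gap 2 q = 0) \<and>
         (1 < q \<and> q < 2 \<longrightarrow> lower_gap 2 q = 0 \<and> upper_gap 3 q = 0)"
proof -
  interpret base q using assms by unfold_locales auto
  have sd: small_diffs using assms by (intro small_diffs_if_not_Pisot)
  have "upper_gap 1 q = 0" if le: "q \<le> root 3 2"
  proof -
    have "q ^ 3 \<le> root 3 2 ^ 3" using le assms by (intro power_mono) auto
    then have q3: "q ^ 3 \<le> 2" by simp
    have "q ^ 2 < q ^ 3" using assms by (intro power_strict_increasing) auto
    then have q2: "q ^ 2 < 2" using q3 by simp
    have gt: "1 < q ^ 2" "1 < q ^ 3" using assms by (simp_all add: one_less_power)
    \<comment> \<open>Since \<open>q\<close> is at most the cube root of 2, both powers stay within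
      the range of \<open>base\<close>, so whichever of them is not Pisot can be used.\<close>
    have "\<not> Pisot (q ^ 2) \<or> \<not> Pisot (q ^ 3)" using Pisot_of_powers assms by blast
    then obtain k where k: "k \<ge> 2" "1 < q ^ k" "q ^ k \<le> 2" "\<not> Pisot (q ^ k)"
    proof
      assume "\<not> Pisot (q ^ 2)"
      then show thesis using that[of 2] gt q2 by simp
    next
      assume "\<not> Pisot (q ^ 3)"
      then show thesis using that[of 3] gt q3 by simp
    qed
    then have "q ^ k < 2" using Pisot_2 by (metis less_eq_real_def)
    have b: "base (q ^ k)" using k by unfold_locales
    then have "base.small_diffs (q ^ k)"
      using base.small_diffs_if_not_Pisot \<open>q ^ k < 2\<close> k by blast
    with upper_gap_eq_0_of_small_diffs_power[OF assms(1) b] k show ?thesis by blast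
  qed
  then show ?thesis
    using lower_gap_eq_0_of_small_diffs[OF sd] upper_gap_eq_0_of_small_diffs[OF sd] by simp
qed

end
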